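(* Let $\mathcal N$ be a quantum channel from $\mathcal L(A')$ to $\mathcal L(B)$ with Choi matrix $J_{\mathcal N}\in\mathcal L(A\otimes B)$ and let $0\le\epsilon<1$ be an error threshold. Then the one-shot $\epsilon$-error NS$\cap$PPT-assisted and NS-assisted classical capacities are given by $$C^{(1)}_{\mathrm{NS}\cap\mathrm{PPT}}(\mathcal N,\epsilon)=-\log\min\Big\{\eta:\ 0\le F_{AB}\le\rho_A\otimes\mathbb 1_B,\ \operatorname{Tr}\rho_A=1,\ \operatorname{Tr}_AF_{AB}=\eta\mathbb 1_B,\ \operatorname{Tr}J_{\mathcal N}F_{AB}\ge1-\epsilon,\ 0\le F_{AB}^{T_B}\le\rho_A\otimes\mathbb 1_B\Big\}$$ and $$C^{(1)}_{\mathrm{NS}}(\mathcal N,\epsilon)=-\log\min\Big\{\eta:\ 0\le F_{AB}\le\rho_A\otimes\mathbb 1_B,\ \operatorname{Tr}\rho_A=1,\ \operatorname{Tr}_AF_{AB}=\eta\mathbb 1_B,\ \operatorname{Tr}J_{\mathcal N}F_{AB}\ge1-\epsilon\Big\},$$ respectively, where the minimum is over $\eta$ and operators $F_{AB}\in\mathcal L(A\otimes B)$, $\rho_A\in\mathcal L(A)$.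
   Context: All Hilbert spaces are finite-dimensional, $A\cong A'$, and $\log$ is the binary logarithm. A quantum channel is a completely positive trace-preserving linear map; its Choi matrix is $J_{\mathcal N}=\sum_{i,j}|i\rangle\langle j|_A\otimes\mathcal N(|i\rangle\langle j|_{A'})$. $T_B$ is the partial transpose on $B$. Codes: write the channel as $\mathcal N(A_o\to B_i)$ (so $A_o$ plays the role of $A$, and $B_i$ of $B$). A code is a bipartite operation $\Pi(A_iB_i\to A_oB_o)$, where Alice holds $A_i,A_o$ and Bob holds $B_i,B_o$; let $Z_{A_iB_iA_oB_o}$ be its Choi matrix, with missing subscripts denoting partial traces. $\Pi$ is a no-signalling (NS) code if $Z_{A_iB_iA_oB_o}\ge0$ (completely positive), $Z_{A_iB_i}=\mathbb 1_{A_iB_i}$ (trace-preserving), $Z_{A_iB_iB_o}=\frac{\mathbb 1_{A_i}}{d_{A_i}}\otimes Z_{B_iB_o}$ (no signalling from Alice to Bob) and $Z_{A_iB_iA_o}=\frac{\mathbb 1_{B_i}}{d_{B_i}}\otimes Z_{A_iA_o}$ (no signalling from Bob to Alice). It is an NS$\cap$PPT code if moreover $Z_{A_iB_iA_oB_o}^{T_{B_iB_o}}\ge0$ (PPT-preserving). Using $\Pi$ with $\mathcal N$ gives a channel $\mathcal M=\Pi\circ\mathcal N$ from $A_i$ to $B_o$ with Choi matrix $J_{\mathcal M}=\operatorname{Tr}_{A_oB_i}(J_{\mathcal N}^T\otimes\mathbb 1_{A_iB_o})Z_{A_iA_oB_iB_o}$. To transmit $m$ messages, $A_i$ and $B_o$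 are classical registers of size $m$ with computational basis $\{|k\rangle\}_{k=1}^m$. The average success probability of the code $\Pi$ is $$f(\mathcal N,\Pi,m)=\frac1m\sum_{k=1}^m\operatorname{Tr}\big(\mathcal M(|k\rangle\langle k|)\,|k\rangle\langle k|\big),$$ and for a class $\Omega$ of codes the optimal average success probability is $f_\Omega(\mathcal N,m)=\sup_{\Pi}f(\mathcal N,\Pi,m)$, the supremum being over codes $\Pi$ in $\Omega$. For $\Omega\in\{\mathrm{NS},\mathrm{NS}\cap\mathrm{PPT}\}$ the one-shot $\epsilon$-error classical capacity assisted by $\Omega$-class codes is $$C^{(1)}_\Omega(\mathcal N,\epsilon)=\sup\{\log\lambda:\ 1-f_\Omega(\mathcal N,\lambda)\le\epsilon\}.$$
   Formalization: Since λ is a number of messages, the formula fails when 1/min η is not an integer (trivial channel, ε=0.1: min η=0.9 but C=0); what is proved is C = log⌊1/min η⌋, with C = −log min η whenever 1/min η is an integer. *)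

theory Defs
  imports "HOL-Analysis.Analysis" "HOL-Library.Complex_Order"
begin

text \<open>
  An operator on a finite-dimensional Hilbert space with a fixed orthonormal basis is given by its
  matrix entries. The basis is a finite index set \<open>S :: 'i set\<close>, which is passed explicitly because
  the number of messages varies inside the capacity; entries outside \<open>S\<close> are never looked at.
  Tensor factors correspond to components of a tuple index. The spaces \<open>A\<close> and \<open>B\<close> of
  the channel are indexed by finite types.
\<close>

type_synonym 'i op = "'i \<Rightarrow> 'i \<Rightarrow> complex"

definition kd :: "'i \<Rightarrow> 'i \<Rightarrow> complex" where
  "kd i j = (if i = j then 1 else 0)"

definition op_mult :: "'i set \<Rightarrow> 'i op \<Rightarrow> 'i op \<Rightarrow> 'i op" where
  "op_mult S X Y = (\<lambda>i j. \<Sum>k\<in>S. X i k * Y k j)"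

definition op_trace :: "'i set \<Rightarrow> 'i op \<Rightarrow> complex" where
  "op_trace S X = (\<Sum>i\<in>S. X i i)"

definition op_tensor :: "'i op \<Rightarrow> 'j op \<Rightarrow> ('i \<times> 'j) op" where
  "op_tensor X Y = (\<lambda>(i, j) (i', j'). X i i' * Y j j')"

definition ketbra :: "'i \<Rightarrow> 'i \<Rightarrow> 'i op" where
  "ketbra k l = (\<lambda>i j. kd i k * kd j l)"

text \<open>In the order on complex numbers used here, \<open>0 \<le> z\<close> says that \<open>z\<close> is real and nonnegative,
  so that the condition below includes Hermiticity on \<open>S\<close>.\<close>

definition psd :: "'i set \<Rightarrow> 'i op \<Rightarrow> bool" where
  "psd S X \<longleftrightarrow> (\<forall>v. 0 \<le> (\<Sum>i\<in>S. \<Sum>j\<in>S. cnj (v i) * X i j * v j))"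

definition loewner_le :: "'i set \<Rightarrow> 'i op \<Rightarrow> 'i op \<Rightarrow> bool" where
  "loewner_le S X Y \<longleftrightarrow> psd S (\<lambda>i j. Y i j - X i j)"

definition trace_fst :: "('a::finite \<times> 'b) op \<Rightarrow> 'b op" where
  "trace_fst X = (\<lambda>b b'. \<Sum>a\<in>UNIV. X (a, b) (a, b'))"

definition ptranspose_snd :: "('a \<times> 'b) op \<Rightarrow> ('a \<times> 'b) op" where
  "ptranspose_snd X = (\<lambda>(a, b) (a', b'). X (a, b') (a', b))"


definition op_linear :: "('a op \<Rightarrow> 'b op) \<Rightarrow> bool" where
  "op_linear N \<longleftrightarrow>
     (\<forall>X Y. N (\<lambda>i j. X i j + Y i j) = (\<lambda>k l. N X k l + N Y k l)) \<and>
     (\<forall>c X. N (\<lambda>i j. c * X i j) = (\<lambda>k l. c * N X k l))"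

definition trace_preserving :: "('a::finite op \<Rightarrow> 'b::finite op) \<Rightarrow> bool" where
  "trace_preserving N \<longleftrightarrow> (\<forall>X. op_trace UNIV (N X) = op_trace UNIV X)"

text \<open>The map \<open>id \<otimes> N\<close>, applied blockwise to an operator with a reference system as first factor.\<close>

definition id_tensor :: "('a op \<Rightarrow> 'b op) \<Rightarrow> ('r \<times> 'a) op \<Rightarrow> ('r \<times> 'b) op" where
  "id_tensor N X = (\<lambda>(r, b) (r', b'). N (\<lambda>a a'. X (r, a) (r', a')) b b')"

definition completely_positive :: "('a::finite op \<Rightarrow> 'b::finite op) \<Rightarrow> bool" where
  "completely_positive N \<longleftrightarrow>
     (\<forall>(n::nat) X. psd ({..<n} \<times> UNIV) X \<longrightarrow> psd ({..<n} \<times> UNIV) (id_tensor N X))"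

definition quantum_channel :: "('a::finite op \<Rightarrow> 'b::finite op) \<Rightarrow> bool" where
  "quantum_channel N \<longleftrightarrow> op_linear N \<and> completely_positive N \<and> trace_preserving N"

definition choi :: "('a::finite op \<Rightarrow> 'b op) \<Rightarrow> ('a \<times> 'b) op" where
  "choi N = (\<lambda>x y. \<Sum>i\<in>UNIV. \<Sum>j\<in>UNIV. op_tensor (ketbra i j) (N (ketbra i j)) x y)"

text \<open>The linear map on operators over the index set \<open>S\<close> that has a given Choi matrix.\<close>

definition map_of_choi :: "'i set \<Rightarrow> ('i \<times> 'j) op \<Rightarrow> 'i op \<Rightarrow> 'j op" where
  "map_of_choi S J X = (\<lambda>k l. \<Sum>i\<in>S. \<Sum>j\<in>S. X i j * J (i, k) (j, l))"


text \<open>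
  A code is given by its Choi matrix \<open>Z\<close>, with indices in the order \<open>(A\<^sub>i, B\<^sub>i, A\<^sub>o, B\<^sub>o)\<close>. Here
  \<open>S\<close> is the index set of \<open>A\<^sub>i\<close> and \<open>T\<close> the one of \<open>B\<^sub>o\<close>. The function \<open>Z_X\<close> is the partial
  trace of \<open>Z\<close> that leaves the subsystems \<open>X\<close>.
\<close>

type_synonym ('i, 'a, 'b, 'j) code = "('i \<times> 'b \<times> 'a \<times> 'j) op"

definition Z_AiBi :: "'j set \<Rightarrow> ('i, 'a::finite, 'b, 'j) code \<Rightarrow> ('i \<times> 'b) op" where
  "Z_AiBi T Z = (\<lambda>(i, b) (i', b'). \<Sum>a\<in>UNIV. \<Sum>j\<in>T. Z (i, b, a, j) (i', b', a, j))"

definition Z_AiBiBo :: "('i, 'a::finite, 'b, 'j) code \<Rightarrow> ('i \<times> 'b \<times> 'j) op" where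
  "Z_AiBiBo Z = (\<lambda>(i, b, j) (i', b', j'). \<Sum>a\<in>UNIV. Z (i, b, a, j) (i', b', a, j'))"

definition Z_BiBo :: "'i set \<Rightarrow> ('i, 'a::finite, 'b, 'j) code \<Rightarrow> ('b \<times> 'j) op" where
  "Z_BiBo S Z = (\<lambda>(b, j) (b', j'). \<Sum>i\<in>S. \<Sum>a\<in>UNIV. Z (i, b, a, j) (i, b', a, j'))"

definition Z_AiBiAo :: "'j set \<Rightarrow> ('i, 'a, 'b, 'j) code \<Rightarrow> ('i \<times> 'b \<times> 'a) op" where
  "Z_AiBiAo T Z = (\<lambda>(i, b, a) (i', b', a'). \<Sum>j\<in>T. Z (i, b, a, j) (i', b', a', j))"

definition Z_AiAo :: "'j set \<Rightarrow> ('i, 'a, 'b::finite, 'j) code \<Rightarrow> ('i \<times> 'a) op" where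
  "Z_AiAo T Z = (\<lambda>(i, a) (i', a'). \<Sum>b\<in>UNIV. \<Sum>j\<in>T. Z (i, b, a, j) (i', b, a', j))"

definition ns_code ::
    "'i set \<Rightarrow> 'j set \<Rightarrow> ('i, 'a::finite, 'b::finite, 'j) code \<Rightarrow> bool" where
  "ns_code S T Z \<longleftrightarrow>
     psd (S \<times> UNIV \<times> UNIV \<times> T) Z \<and>
     (\<forall>x\<in>S \<times> UNIV. \<forall>y\<in>S \<times> UNIV. Z_AiBi T Z x y = kd x y) \<and>
     (\<forall>i\<in>S. \<forall>i'\<in>S. \<forall>b b'. \<forall>j\<in>T. \<forall>j'\<in>T.
        Z_AiBiBo Z (i, b, j) (i', b', j') =
        kd i i' / of_nat (card S) * Z_BiBo S Z (b, j) (b', j')) \<and>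
     (\<forall>i\<in>S. \<forall>i'\<in>S. \<forall>b b' a a'.
        Z_AiBiAo T Z (i, b, a) (i', b', a') =
        kd b b' / of_nat CARD('b) * Z_AiAo T Z (i, a) (i', a'))"

definition ptranspose_BiBo :: "('i, 'a, 'b, 'j) code \<Rightarrow> ('i, 'a, 'b, 'j) code" where
  "ptranspose_BiBo Z = (\<lambda>(i, b, a, j) (i', b', a', j'). Z (i, b', a, j') (i', b, a', j))"

definition ppt_code :: "'i set \<Rightarrow> 'j set \<Rightarrow> ('i, 'a, 'b, 'j) code \<Rightarrow> bool" where
  "ppt_code S T Z \<longleftrightarrow> psd (S \<times> UNIV \<times> UNIV \<times> T) (ptranspose_BiBo Z)"

text \<open>Classical input and output registers \<open>A\<^sub>i\<close> and \<open>B\<^sub>o\<close>: no coherences between different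
  computational basis states of these registers.\<close>

definition classical_registers :: "'i set \<Rightarrow> 'j set \<Rightarrow> ('i, 'a, 'b, 'j) code \<Rightarrow> bool" where
  "classical_registers S T Z \<longleftrightarrow>
     (\<forall>i\<in>S. \<forall>i'\<in>S. \<forall>j\<in>T. \<forall>j'\<in>T. \<forall>b b' a a'.
        i \<noteq> i' \<or> j \<noteq> j' \<longrightarrow> Z (i, b, a, j) (i', b', a', j') = 0)"

text \<open>The Choi matrix \<open>Tr\<^bsub>A\<^sub>oB\<^sub>i\<^esub> (J\<^sup>T \<otimes> \<one>\<^bsub>A\<^sub>iB\<^sub>o\<^esub>) Z\<close> of the channel from \<open>A\<^sub>i\<close> to \<open>B\<^sub>o\<close>
  obtained by using the code \<open>Z\<close> with a channel that has Choi matrix \<open>J\<close>.\<close>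

definition lift_transpose :: "('a \<times> 'b) op \<Rightarrow> ('i, 'a, 'b, 'j) code" where
  "lift_transpose J =
     (\<lambda>(i, b, a, j) (i', b', a', j'). J (a', b') (a, b) * kd i i' * kd j j')"

definition composed_choi ::
    "'i set \<Rightarrow> 'j set \<Rightarrow> ('a::finite \<times> 'b::finite) op \<Rightarrow> ('i, 'a, 'b, 'j) code
      \<Rightarrow> ('i \<times> 'j) op" where
  "composed_choi S T J Z = (\<lambda>(i, j) (i', j'). \<Sum>b\<in>UNIV. \<Sum>a\<in>UNIV.
     op_mult (S \<times> UNIV \<times> UNIV \<times> T) (lift_transpose J) Z (i, b, a, j) (i', b, a, j'))"

definition composed_channel ::
    "'i set \<Rightarrow> 'j set \<Rightarrow> ('a::finite op \<Rightarrow> 'b::finite op) \<Rightarrow> ('i, 'a, 'b, 'j) code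
      \<Rightarrow> 'i op \<Rightarrow> 'j op" where
  "composed_channel S T N Z = map_of_choi S (composed_choi S T (choi N) Z)"


type_synonym ('a, 'b) message_code = "(nat, 'a, 'b, nat) code"

definition success_prob ::
    "('a::finite op \<Rightarrow> 'b::finite op) \<Rightarrow> ('a, 'b) message_code \<Rightarrow> nat \<Rightarrow> real" where
  "success_prob N Z m =
     (1 / real m) * (\<Sum>k = 1..m. Re (op_trace {1..m}
        (op_mult {1..m} (composed_channel {1..m} {1..m} N Z (ketbra k k)) (ketbra k k))))"

definition ns_codes :: "nat \<Rightarrow> ('a::finite, 'b::finite) message_code set" where
  "ns_codes m = {Z. classical_registers {1..m} {1..m} Z \<and> ns_code {1..m} {1..m} Z}"

definition ns_ppt_codes :: "nat \<Rightarrow> ('a::finite, 'b::finite) message_code set" where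
  "ns_ppt_codes m = {Z \<in> ns_codes m. ppt_code {1..m} {1..m} Z}"

definition opt_success_prob ::
    "(nat \<Rightarrow> ('a, 'b) message_code set) \<Rightarrow> ('a::finite op \<Rightarrow> 'b::finite op) \<Rightarrow> nat \<Rightarrow> real" where
  "opt_success_prob \<Omega> N m = (SUP Z\<in>\<Omega> m. success_prob N Z m)"

text \<open>The number of messages is a register size, so the capacity is the logarithm of a positive
  integer; it equals \<open>- log 2 \<eta>\<close>, for the optimal value \<open>\<eta>\<close> of the corresponding semidefinite program,
  only up to rounding \<open>1 / \<eta>\<close> down to an integer.\<close>

definition one_shot_capacity ::
    "(nat \<Rightarrow> ('a, 'b) message_code set) \<Rightarrow> ('a::finite op \<Rightarrow> 'b::finite op) \<Rightarrow> real \<Rightarrow> real" where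
  "one_shot_capacity \<Omega> N \<epsilon> =
     Sup {log 2 (real l) | l::nat. 1 \<le> l \<and> 1 - opt_success_prob \<Omega> N l \<le> \<epsilon>}"


definition ns_feasible ::
    "('a::finite \<times> 'b::finite) op \<Rightarrow> real \<Rightarrow> real \<Rightarrow> ('a \<times> 'b) op \<Rightarrow> 'a op \<Rightarrow> bool" where
  "ns_feasible J \<epsilon> \<eta> F \<rho> \<longleftrightarrow>
     psd UNIV F \<and> loewner_le UNIV F (op_tensor \<rho> kd) \<and>
     op_trace UNIV \<rho> = 1 \<and>
     trace_fst F = (\<lambda>b b'. of_real \<eta> * kd b b') \<and>
     of_real (1 - \<epsilon>) \<le> op_trace UNIV (op_mult UNIV J F)"

definition ns_ppt_feasible ::
    "('a::finite \<times> 'b::finite) op \<Rightarrow> real \<Rightarrow> real \<Rightarrow> ('a \<times> 'b) op \<Rightarrow> 'a op \<Rightarrow> bool" where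
  "ns_ppt_feasible J \<epsilon> \<eta> F \<rho> \<longleftrightarrow>
     ns_feasible J \<epsilon> \<eta> F \<rho> \<and>
     psd UNIV (ptranspose_snd F) \<and> loewner_le UNIV (ptranspose_snd F) (op_tensor \<rho> kd)"

definition is_minimum :: "real set \<Rightarrow> real \<Rightarrow> bool" where
  "is_minimum E \<eta> \<longleftrightarrow> \<eta> \<in> E \<and> (\<forall>\<eta>'\<in>E. \<eta> \<le> \<eta>')"

end

theory Submission
  imports Defs
begin

text \<open>
  Since \<open>A\<^sub>i\<close> and \<open>B\<^sub>o\<close> are classical, a code for \<open>m\<close> messages is a family of blocks
  \<open>Z\<^sub>i\<^sub>j\<close> on \<open>A\<^sub>oB\<^sub>i\<close>. Averaging the (transposed) diagonal blocks gives \<open>F\<close>, and averaging all row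
  sums gives \<open>\<rho> \<otimes> \<one>\<close> by no-signalling from Bob to Alice; no-signalling from Alice to Bob
  forces \<open>Tr\<^sub>A F = \<one> / m\<close>, and the success probability is \<open>Tr J F\<close>. Conversely, \<open>F\<close> on the
  diagonal and \<open>(\<rho> \<otimes> \<one> - F) / (m - 1)\<close> off the diagonal is a code. So \<open>m\<close> messages reach
  error \<open>\<epsilon>\<close> iff \<open>\<eta> = 1 / m\<close> is feasible; compactness of the set of all \<open>(\<eta>, F, \<rho>)\<close> makes both
  the supremum over codes and the infimum over \<open>\<eta>\<close> attained. Mixing with \<open>\<rho> \<otimes> \<one>\<close> shows that the feasible
  \<open>\<eta>\<close> form an interval ending at 1, which gives the floor of \<open>1 / \<eta>\<close>.
\<close>

section \<open>Positive semidefinite operators\<close>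

abbreviation quad_form :: "'i set \<Rightarrow> 'i op \<Rightarrow> ('i \<Rightarrow> complex) \<Rightarrow> complex" where
  "quad_form S X v \<equiv> \<Sum>i\<in>S. \<Sum>j\<in>S. cnj (v i) * X i j * v j"

lemma complex_nonneg_iff: "0 \<le> (z::complex) \<longleftrightarrow> 0 \<le> Re z \<and> Im z = 0"
  by (auto simp: less_eq_complex_def)

lemma psdD: "psd S X \<Longrightarrow> 0 \<le> quad_form S X v"
  by (simp add: psd_def)

lemma psd_add:
  assumes "psd S X" "psd S Y"
  shows "psd S (\<lambda>i j. X i j + Y i j)"
proof -
  have "quad_form S (\<lambda>i j. X i j + Y i j) v = quad_form S X v + quad_form S Y v" for v
    by (simp add: algebra_simps sum.distrib)
  then show ?thesis
    using assms by (simp add: psd_def)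
qed

lemma psd_scale:
  assumes "psd S X" "0 \<le> c"
  shows "psd S (\<lambda>i j. of_real c * X i j)"
proof -
  have "quad_form S (\<lambda>i j. of_real c * X i j) v = of_real c * quad_form S X v" for v
    by (simp add: algebra_simps sum_distrib_left)
  then show ?thesis
    using assms by (simp add: psd_def complex_nonneg_iff)
qed

lemma psd_zero: "psd S (\<lambda>i j. 0)"
  by (simp add: psd_def)

lemma psd_sum:
  assumes "\<And>k. k \<in> K \<Longrightarrow> psd S (X k)"
  shows "psd S (\<lambda>i j. \<Sum>k\<in>K. X k i j)"
  using assms
  by (induction K rule: infinite_finite_induct) (simp_all add: psd_zero psd_add)

text \<open>Test vectors supported on two indices isolate a 2 by 2 principal submatrix; suitable
  \<open>c\<close> and \<open>d\<close> give Hermiticity and the bound of entries by the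
  trace.\<close>

lemma quad_form_two_points:
  assumes "finite S" "i \<in> S" "j \<in> S" "i \<noteq> j"
  shows "quad_form S X (\<lambda>k. if k = i then c else if k = j then d else 0) =
    cnj c * X i i * c + cnj c * X i j * d + cnj d * X j i * c + cnj d * X j j * d"
proof -
  let ?v = "\<lambda>k. if k = i then c else if k = j then d else 0"
  have "(\<Sum>y\<in>S. cnj (?v x) * X x y * ?v y) = (\<Sum>y\<in>{i, j}. cnj (?v x) * X x y * ?v y)" for x
    using assms by (intro sum.mono_neutral_right) auto
  moreover have "(\<Sum>x\<in>S. \<Sum>y\<in>{i, j}. cnj (?v x) * X x y * ?v y) =
      (\<Sum>x\<in>{i, j}. \<Sum>y\<in>{i, j}. cnj (?v x) * X x y * ?v y)"
    using assms by (intro sum.mono_neutral_right) auto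
  ultimately show ?thesis
    using assms by (simp add: add.assoc)
qed

lemma psd_diagonal:
  assumes "psd S X" "finite S" "i \<in> S"
  shows "0 \<le> X i i"
proof -
  let ?v = "\<lambda>k. if k = i then 1 else 0"
  have "quad_form S X ?v = X i i"
  proof -
    have "(\<Sum>y\<in>S. cnj (?v x) * X x y * ?v y) = (if x = i then X i i else 0)" for x
      using assms by (simp add: if_distrib [of "\<lambda>t. _ * t"] cong: if_cong)
    then show ?thesis
      using assms by simp
  qed
  moreover have "0 \<le> quad_form S X ?v"
    by (rule psdD [OF assms(1)])
  ultimately show ?thesis
    by simp
qed

lemma psd_hermitian:
  assumes "psd S X" "finite S" "i \<in> S" "j \<in> S"
  shows "X j i = cnj (X i j)"
proof (cases "i = j")
  case True
  then show ?thesis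
    using psd_diagonal [OF assms(1,2,4)] by (simp add: complex_nonneg_iff complex_eq_iff)
next
  case False
  have q: "0 \<le> cnj c * X i i * c + cnj c * X i j * d + cnj d * X j i * c + cnj d * X j j * d" for c d
    using psdD [OF assms(1), of "\<lambda>k. if k = i then c else if k = j then d else 0"]
    unfolding quad_form_two_points [OF assms(2-4) False] .
  have d: "Im (X i i) = 0" "Im (X j j) = 0"
    using psd_diagonal [OF assms(1,2)] assms(3,4) by (auto simp: complex_nonneg_iff)
  \<comment> \<open>The form is real, so the coefficients (1, 1) make the imaginary parts of
    \<open>X i j\<close> and \<open>X j i\<close> opposite, and (1, \<open>\<i>\<close>) makes their
    real parts equal.\<close>
  show ?thesis
    using q [of 1 1] q [of 1 \<i>] d by (simp add: complex_nonneg_iff complex_eq_iff)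
qed

lemma psd_trace_nonneg:
  assumes "psd S X" "finite S"
  shows "0 \<le> op_trace S X"
  unfolding op_trace_def using assms by (intro sum_nonneg psd_diagonal)

text \<open>Supplies boundedness for the compactness argument, where traces are what the constraints
  control. A 2 by 2 principal submatrix bounds twice the modulus of its off-diagonal entry by the
  sum of its diagonal.\<close>

lemma psd_entry_le_trace:
  assumes "psd S X" "finite S" "i \<in> S" "j \<in> S"
  shows "cmod (X i j) \<le> Re (op_trace S X)"
proof -
  have nn: "0 \<le> Re (X k k)" "Im (X k k) = 0" if "k \<in> S" for k
    using psd_diagonal [OF assms(1,2) that] by (auto simp: complex_nonneg_iff)
  show ?thesis
  proof (cases "i = j")
    case True
    have "cmod (X i j) = Re (X i i)"
      using nn [OF assms(3)] True by (simp add: cmod_def)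
    also have "\<dots> \<le> Re (op_trace S X)"
      unfolding op_trace_def Re_sum using nn assms by (intro member_le_sum) auto
    finally show ?thesis .
  next
    case False
    define z where "z = X i j"
    have q: "0 \<le> cnj c * X i i * c + cnj c * X i j * d + cnj d * X j i * c + cnj d * X j j * d"
      for c d
      using psdD [OF assms(1), of "\<lambda>k. if k = i then c else if k = j then d else 0"]
      unfolding quad_form_two_points [OF assms(2-4) False] .
    have h: "X j i = cnj z"
      using psd_hermitian [OF assms] by (simp add: z_def)
    have pair: "Re (X i i) + Re (X j j) \<le> Re (op_trace S X)"
    proof -
      have "(\<Sum>k\<in>{i, j}. Re (X k k)) \<le> (\<Sum>k\<in>S. Re (X k k))"
        using nn assms by (intro sum_mono2) auto
      then show ?thesis
        using False by (simp add: op_trace_def)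
    qed
    show ?thesis
    proof (cases "z = 0")
      case True
      then show ?thesis
        using psd_trace_nonneg [OF assms(1,2)] by (simp add: z_def complex_nonneg_iff)
    next
      case z: False
      \<comment> \<open>A phase that turns both cross terms into \<open>- cmod z\<close>, so that
        nonnegativity of the form bounds \<open>2 * cmod z\<close> by two diagonal entries.\<close>
      define d where "d = - cnj z / of_real (cmod z)"
      have zz: "z * cnj z = of_real (cmod z) * of_real (cmod z)"
        by (simp add: power2_eq_square flip: complex_norm_square)
      have zd: "z * d = - of_real (cmod z)"
        using z zz by (simp add: d_def)
      have dd: "cnj d * d = 1"
        using z zz by (simp add: d_def field_simps)
      have zd': "cnj d * cnj z = - of_real (cmod z)"
        using arg_cong [OF zd, of cnj] by (simp add: mult.commute)
      have "0 \<le> X i i + z * d + cnj d * cnj z + (cnj d * d) * X j j"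
        using q [of 1 d] by (simp add: z_def h [unfolded z_def] mult_ac)
      then have "2 * cmod z \<le> Re (X i i) + Re (X j j)"
        unfolding zd zd' dd by (simp add: complex_nonneg_iff)
      then show ?thesis
        using pair norm_ge_zero [of z] unfolding z_def by linarith
    qed
  qed
qed

lemma psd_trace_zero:
  assumes "psd UNIV (X :: 'i::finite op)" "op_trace UNIV X = 0"
  shows "X i j = 0"
  using psd_entry_le_trace [OF assms(1), of i j] assms(2) by simp

text \<open>Conjugation swaps the indices of Hermitian operators, and exchanging the two sums undoes
  this. The success constraint of the programs is an inequality of complex numbers and hence
  includes this reality.\<close>

lemma trace_mult_psd_real:
  assumes "psd UNIV (X :: 'i::finite op)" "psd UNIV Y"
  shows "Im (op_trace UNIV (op_mult UNIV X Y)) = 0"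
proof -
  have "cnj (op_trace UNIV (op_mult UNIV X Y)) = (\<Sum>i\<in>UNIV. \<Sum>k\<in>UNIV. X k i * Y i k)"
    unfolding op_trace_def op_mult_def
    by (simp flip: psd_hermitian [OF assms(1)] psd_hermitian [OF assms(2)])
  also have "\<dots> = op_trace UNIV (op_mult UNIV X Y)"
    unfolding op_trace_def op_mult_def by (rule sum.swap)
  finally show ?thesis
    by (simp add: complex_eq_iff)
qed

section \<open>Codes with classical registers\<close>

text \<open>The systems \<open>A\<^sub>o\<close> and \<open>B\<^sub>i\<close> are transposed here because \<open>composed_choi\<close> pairs the code with the
  transpose of the Choi matrix, whereas the programs pair \<open>F\<close> with the Choi matrix itself.\<close>

definition block :: "('i, 'a, 'b, 'j) code \<Rightarrow> 'i \<Rightarrow> 'j \<Rightarrow> ('a \<times> 'b) op" where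
  "block Z i j = (\<lambda>(a, b) (a', b'). Z (i, b', a', j) (i, b, a, j))"

text \<open>The classical labels move outside and \<open>(a, b)\<close> becomes a single index,
  matching the shape of \<open>block\<close>.\<close>

lemma sum_code_index:
  fixes f :: "'i \<times> 'b::finite \<times> 'a::finite \<times> 'j \<Rightarrow> complex"
  shows "(\<Sum>x\<in>S \<times> UNIV \<times> UNIV \<times> T. f x) =
    (\<Sum>i\<in>S. \<Sum>j\<in>T. \<Sum>y\<in>UNIV. f (i, snd y, fst y, j))"
proof -
  have "(\<Sum>b\<in>UNIV. \<Sum>a\<in>UNIV. \<Sum>j\<in>T. f (i, b, a, j)) =
      (\<Sum>j\<in>T. \<Sum>y\<in>UNIV. f (i, snd y, fst y, j))" for i
  proof -
    have "(\<Sum>j\<in>T. \<Sum>y\<in>UNIV. f (i, snd y, fst y, j)) =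
        (\<Sum>j\<in>T. \<Sum>a\<in>UNIV. \<Sum>b\<in>UNIV. f (i, b, a, j))"
      by (simp add: sum.cartesian_product' flip: UNIV_Times_UNIV)
    also have "\<dots> = (\<Sum>j\<in>T. \<Sum>b\<in>UNIV. \<Sum>a\<in>UNIV. f (i, b, a, j))"
      by (intro sum.cong refl sum.swap)
    also have "\<dots> = (\<Sum>b\<in>UNIV. \<Sum>j\<in>T. \<Sum>a\<in>UNIV. f (i, b, a, j))"
      by (rule sum.swap)
    also have "\<dots> = (\<Sum>b\<in>UNIV. \<Sum>a\<in>UNIV. \<Sum>j\<in>T. f (i, b, a, j))"
      by (intro sum.cong refl sum.swap)
    finally show ?thesis ..
  qed
  then show ?thesis
    by (simp add: sum.cartesian_product')
qed

lemma sum_if_pair: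
  fixes f :: "'i \<Rightarrow> 'j \<Rightarrow> 'c::comm_monoid_add"
  assumes "finite S" "finite T" "i \<in> S" "j \<in> T"
    and "\<And>i' j'. i' \<in> S \<Longrightarrow> j' \<in> T \<Longrightarrow> i' \<noteq> i \<or> j' \<noteq> j \<Longrightarrow> f i' j' = 0"
  shows "(\<Sum>i'\<in>S. \<Sum>j'\<in>T. f i' j') = f i j"
proof -
  have "(\<Sum>i'\<in>S. \<Sum>j'\<in>T. f i' j') = (\<Sum>p\<in>S \<times> T. f (fst p) (snd p))"
    by (simp add: sum.cartesian_product')
  also have "\<dots> = (\<Sum>p\<in>{(i, j)}. f (fst p) (snd p))"
    using assms(1-4) by (intro sum.mono_neutral_right) (auto intro!: assms(5))
  finally show ?thesis
    by simp
qed

text \<open>Without coherences only equal classical labels contribute. The transposition in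
  \<open>block\<close> is compensated by conjugating the test vector.\<close>

lemma quad_form_blocks:
  fixes Z :: "('i, 'a::finite, 'b::finite, 'j) code"
  assumes "classical_registers S T Z" "finite S" "finite T"
  shows "quad_form (S \<times> UNIV \<times> UNIV \<times> T) Z v =
    (\<Sum>i\<in>S. \<Sum>j\<in>T. quad_form UNIV (block Z i j) (\<lambda>(a, b). cnj (v (i, b, a, j))))"
proof -
  have "(\<Sum>x\<in>UNIV. \<Sum>i'\<in>S. \<Sum>j'\<in>T. \<Sum>y\<in>UNIV.
        cnj (v (i, snd x, fst x, j)) * Z (i, snd x, fst x, j) (i', snd y, fst y, j')
          * v (i', snd y, fst y, j')) =
      quad_form UNIV (block Z i j) (\<lambda>(a, b). cnj (v (i, b, a, j)))" (is "?l = ?r")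
    if "i \<in> S" "j \<in> T" for i j
  proof -
    have "?l = (\<Sum>x\<in>UNIV. \<Sum>y\<in>UNIV.
        cnj (v (i, snd x, fst x, j)) * Z (i, snd x, fst x, j) (i, snd y, fst y, j)
          * v (i, snd y, fst y, j))"
      using assms that by (intro sum.cong refl sum_if_pair) (auto simp: classical_registers_def)
    also have "\<dots> = ?r"
      by (subst sum.swap) (simp add: block_def case_prod_beta mult_ac)
    finally show ?thesis .
  qed
  then show ?thesis
    by (simp add: sum_code_index)
qed

lemma psd_code_iff:
  fixes Z :: "('i, 'a::finite, 'b::finite, 'j) code"
  assumes "classical_registers S T Z" "finite S" "finite T"
  shows "psd (S \<times> UNIV \<times> UNIV \<times> T) Z \<longleftrightarrow> (\<forall>i\<in>S. \<forall>j\<in>T. psd UNIV (block Z i j))"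
proof
  assume Z: "psd (S \<times> UNIV \<times> UNIV \<times> T) Z"
  show "\<forall>i\<in>S. \<forall>j\<in>T. psd UNIV (block Z i j)"
  proof (intro ballI)
    fix i j assume ij: "i \<in> S" "j \<in> T"
    show "psd UNIV (block Z i j)"
      unfolding psd_def
    proof
      fix w :: "'a \<times> 'b \<Rightarrow> complex"
      \<comment> \<open>A test vector supported on one pair of labels, conjugated because
        \<open>block\<close> is transposed.\<close>
      define v where "v = (\<lambda>(i', b, a, j'). if i' = i \<and> j' = j then cnj (w (a, b)) else 0)"
      have "quad_form (S \<times> UNIV \<times> UNIV \<times> T) Z v =
          quad_form UNIV (block Z i j) (\<lambda>(a, b). cnj (v (i, b, a, j)))"
        unfolding quad_form_blocks [OF assms]
        by (rule sum_if_pair [OF assms(2,3) ij]) (auto simp: v_def case_prod_beta)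
      also have "\<dots> = quad_form UNIV (block Z i j) w"
        by (simp add: v_def case_prod_beta)
      finally show "0 \<le> quad_form UNIV (block Z i j) w"
        using psdD [OF Z, of v] by (simp only:)
    qed
  qed
next
  assume "\<forall>i\<in>S. \<forall>j\<in>T. psd UNIV (block Z i j)"
  then show "psd (S \<times> UNIV \<times> UNIV \<times> T) Z"
    by (simp add: psd_def quad_form_blocks [OF assms] sum_nonneg)
qed

lemma classical_registers_ptranspose:
  "classical_registers S T Z \<Longrightarrow> classical_registers S T (ptranspose_BiBo Z)"
  by (auto simp: classical_registers_def ptranspose_BiBo_def)

text \<open>Within a block the two \<open>B\<^sub>o\<close> indices coincide, so only the
  transposition of \<open>B\<^sub>i\<close> is visible, and it commutes with the full transposition
  in \<open>block\<close>.\<close>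

lemma block_ptranspose: "block (ptranspose_BiBo Z) i j = ptranspose_snd (block Z i j)"
  by (simp add: block_def ptranspose_BiBo_def ptranspose_snd_def case_prod_beta fun_eq_iff)

lemma ppt_code_iff:
  fixes Z :: "('i, 'a::finite, 'b::finite, 'j) code"
  assumes "classical_registers S T Z" "finite S" "finite T"
  shows "ppt_code S T Z \<longleftrightarrow> (\<forall>i\<in>S. \<forall>j\<in>T. psd UNIV (ptranspose_snd (block Z i j)))"
  unfolding ppt_code_def
  by (simp add: psd_code_iff [OF classical_registers_ptranspose [OF assms(1)] assms(2,3)]
      block_ptranspose)

section \<open>Success probability as a trace with the Choi matrix\<close>

definition sdp_value :: "('a::finite \<times> 'b::finite) op \<Rightarrow> ('a \<times> 'b) op \<Rightarrow> real" where
  "sdp_value J F = Re (op_trace UNIV (op_mult UNIV J F))"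

text \<open>The transposes in \<open>lift_transpose\<close> and in \<open>block\<close> cancel, and
  the Kronecker deltas in \<open>lift_transpose\<close> single out the block with labels
  \<open>k, k\<close>.\<close>

lemma composed_choi_diagonal:
  fixes Z :: "('i, 'a::finite, 'b::finite, 'i) code"
  assumes "finite S" "k \<in> S"
  shows "composed_choi S S J Z (k, k) (k, k) = op_trace UNIV (op_mult UNIV J (block Z k k))"
proof -
  have "op_mult (S \<times> UNIV \<times> UNIV \<times> S) (lift_transpose J) Z (k, b, a, k) (k, b, a, k) =
      (\<Sum>y\<in>UNIV. J y (a, b) * block Z k k (a, b) y)" for a b
    unfolding op_mult_def sum_code_index
    by (subst sum_if_pair [of S S k k])
      (use assms in \<open>auto simp: lift_transpose_def kd_def block_def case_prod_beta\<close>)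
  then have "composed_choi S S J Z (k, k) (k, k) =
      (\<Sum>b\<in>UNIV. \<Sum>a\<in>UNIV. \<Sum>y\<in>UNIV. J y (a, b) * block Z k k (a, b) y)"
    by (simp add: composed_choi_def)
  also have "\<dots> = (\<Sum>a\<in>UNIV. \<Sum>b\<in>UNIV. \<Sum>y\<in>UNIV. J y (a, b) * block Z k k (a, b) y)"
    by (rule sum.swap)
  also have "\<dots> = (\<Sum>x\<in>UNIV. \<Sum>y\<in>UNIV. J y x * block Z k k x y)"
    by (simp add: sum.cartesian_product' flip: UNIV_Times_UNIV)
  also have "\<dots> = op_trace UNIV (op_mult UNIV J (block Z k k))"
    unfolding op_trace_def op_mult_def by (rule sum.swap)
  finally show ?thesis .
qed

lemma success_prob_blocks:
  "success_prob N Z m = (1 / real m) * (\<Sum>k = 1..m. sdp_value (choi N) (block Z k k))"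
proof -
  have "op_trace {1..m}
        (op_mult {1..m} (composed_channel {1..m} {1..m} N Z (ketbra k k)) (ketbra k k))
      = op_trace UNIV (op_mult UNIV (choi N) (block Z k k))" if k: "k \<in> {1..m}" for k
  proof -
    have "op_trace {1..m} (op_mult {1..m} M (ketbra k k)) = M k k" for M :: "nat op"
      unfolding op_trace_def op_mult_def
      by (subst sum_if_pair [of "{1..m}" "{1..m}" k k]) (use k in \<open>auto simp: ketbra_def kd_def\<close>)
    moreover have "composed_channel {1..m} {1..m} N Z (ketbra k k) k k =
        composed_choi {1..m} {1..m} (choi N) Z (k, k) (k, k)"
      unfolding composed_channel_def map_of_choi_def
      by (subst sum_if_pair [of "{1..m}" "{1..m}" k k]) (use k in \<open>auto simp: ketbra_def kd_def\<close>)
    ultimately show ?thesis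
      using k by (simp add: composed_choi_diagonal)
  qed
  then show ?thesis
    by (simp add: success_prob_def sdp_value_def)
qed

section \<open>The semidefinite programs\<close>

text \<open>The constraints that mention neither the channel nor \<epsilon>. One compact set then
  serves both for maximizing success at fixed \<eta> and for minimizing \<eta>, and the flag lets
  one argument cover both capacities.\<close>

definition sdp_point ::
    "bool \<Rightarrow> real \<Rightarrow> ('a::finite \<times> 'b::finite) op \<Rightarrow> 'a op \<Rightarrow> bool" where
  "sdp_point ppt \<eta> F \<rho> \<longleftrightarrow>
     psd UNIV F \<and> loewner_le UNIV F (op_tensor \<rho> kd) \<and>
     op_trace UNIV \<rho> = 1 \<and>
     trace_fst F = (\<lambda>b b'. of_real \<eta> * kd b b') \<and>
     (ppt \<longrightarrow> psd UNIV (ptranspose_snd F) \<and> loewner_le UNIV (ptranspose_snd F) (op_tensor \<rho> kd))"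

section \<open>Kronecker deltas and the Choi matrix of a channel\<close>

lemma kd_simps [simp]: "kd i i = 1" "i \<noteq> j \<Longrightarrow> kd i j = 0"
  by (simp_all add: kd_def)

lemma kd_commute: "kd i j = kd j i"
  by (simp add: kd_def)

lemma sum_kd [simp]:
  "(\<Sum>j\<in>UNIV. kd i j * f j) = f (i::'i::finite)"
  "(\<Sum>j\<in>UNIV. kd j i * f j) = f i"
  "(\<Sum>j\<in>UNIV. f j * kd i j) = f i"
  "(\<Sum>j\<in>UNIV. f j * kd j i) = f i"
  by (simp_all add: kd_def if_distrib if_distribR cong: if_cong)

lemma choi_apply: "choi N (a, b) (a', b') = N (ketbra a a') b b'"
proof -
  have "choi N (a, b) (a', b') =
      (\<Sum>i\<in>UNIV. \<Sum>j\<in>UNIV. kd a i * (kd a' j * N (ketbra i j) b b'))"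
    by (simp add: choi_def op_tensor_def ketbra_def mult.assoc)
  then show ?thesis
    by (simp flip: sum_distrib_left)
qed

lemma sum_UNIV_pair:
  "(\<Sum>x\<in>UNIV. f x) = (\<Sum>a\<in>UNIV. \<Sum>b\<in>UNIV. f (a :: 'a::finite, b :: 'b::finite))"
  by (simp add: sum.cartesian_product' flip: UNIV_Times_UNIV)

lemma op_trace_tensor_kd:
  "op_trace UNIV (op_tensor \<rho> (kd :: 'b::finite op)) = of_nat CARD('b) * op_trace UNIV \<rho>"
  for \<rho> :: "'a::finite op"
  by (simp add: op_trace_def op_tensor_def sum_UNIV_pair sum_distrib_left)

lemma op_trace_trace_fst:
  "op_trace UNIV (trace_fst X) = op_trace UNIV X" for X :: "('a::finite \<times> 'b::finite) op"
  unfolding op_trace_def trace_fst_def sum_UNIV_pair by (rule sum.swap)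

text \<open>The reference system ranges over natural numbers in \<open>completely_positive\<close>, hence the
  enumeration of the input basis.\<close>

lemma psd_choi:
  fixes N :: "'a::finite op \<Rightarrow> 'b::finite op"
  assumes "completely_positive N"
  shows "psd UNIV (choi N)"
proof -
  obtain e where e: "bij_betw e {..<CARD('a)} (UNIV :: 'a set)"
    using ex_bij_betw_nat_finite [of "UNIV :: 'a set"] by (auto simp: atLeast0LessThan)
  \<comment> \<open>The unnormalised maximally entangled operator. It has rank one, so its form is
    the squared modulus of a linear functional, and \<open>id_tensor N\<close> maps it to the Choi
    matrix up to the enumeration \<open>e\<close>.\<close>
  define X :: "(nat \<times> 'a) op" where "X = (\<lambda>(r, a) (r', a'). kd (e r) a * kd (e r') a')"
  have "psd ({..<CARD('a)} \<times> UNIV) X"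
  proof -
    have "quad_form ({..<CARD('a)} \<times> UNIV) X v =
        cnj (\<Sum>x\<in>{..<CARD('a)} \<times> UNIV. kd (e (fst x)) (snd x) * v x) *
        (\<Sum>x\<in>{..<CARD('a)} \<times> UNIV. kd (e (fst x)) (snd x) * v x)" for v
      unfolding cnj_sum sum_product
      by (intro sum.cong refl) (auto simp: X_def kd_def)
    moreover have "0 \<le> cnj z * z" for z
      by (simp add: complex_nonneg_iff)
    ultimately show ?thesis
      unfolding psd_def by (simp only: simp_thms)
  qed
  then have *: "psd ({..<CARD('a)} \<times> UNIV) (id_tensor N X)"
    using assms unfolding completely_positive_def by blast
  have id: "id_tensor N X (r, b) (r', b') = choi N (e r, b) (e r', b')" for r b r' b'
  proof -
    have "(\<lambda>a a'. X (r, a) (r', a')) = ketbra (e r) (e r')"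
      by (simp add: fun_eq_iff X_def ketbra_def kd_commute)
    then show ?thesis
      by (simp add: id_tensor_def choi_apply)
  qed
  have "quad_form UNIV (choi N) v =
      quad_form ({..<CARD('a)} \<times> UNIV) (id_tensor N X) (\<lambda>(r, b). v (e r, b))" for v
  proof -
    have re: "(\<Sum>x\<in>UNIV. f x) = (\<Sum>x\<in>{..<CARD('a)} \<times> UNIV. f (e (fst x), snd x))"
      for f :: "'a \<times> 'b \<Rightarrow> complex"
      by (simp add: sum_UNIV_pair sum.cartesian_product' sum.reindex_bij_betw [OF e, symmetric])
    show ?thesis
      by (simp add: re id case_prod_beta) (auto simp: id case_prod_beta intro!: sum.cong)
  qed
  then have "0 \<le> quad_form UNIV (choi N) v" for v
    using psdD [OF *, of "\<lambda>(r, b). v (e r, b)"] by (simp only:)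
  then show ?thesis
    unfolding psd_def by blast
qed

text \<open>Trace preservation makes the partial trace of the Choi matrix over B the identity. Hence
  \<rho> tensored with the identity has value 1 when \<rho> has trace 1.\<close>

lemma trace_choi_tensor_kd:
  fixes N :: "'a::finite op \<Rightarrow> 'b::finite op"
  assumes "trace_preserving N"
  shows "op_trace UNIV (op_mult UNIV (choi N) (op_tensor \<rho> kd)) = op_trace UNIV \<rho>"
proof -
  have tp: "(\<Sum>b\<in>UNIV. N (ketbra a a') b b) = kd a a'" for a a'
  proof -
    have "(\<Sum>b\<in>UNIV. N (ketbra a a') b b) = (\<Sum>i\<in>UNIV. kd i a * kd i a')"
      using assms by (simp add: trace_preserving_def op_trace_def ketbra_def)
    then show ?thesis
      by simp
  qed
  have "op_trace UNIV (op_mult UNIV (choi N) (op_tensor \<rho> kd)) =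
      (\<Sum>a\<in>UNIV. \<Sum>b\<in>UNIV. \<Sum>a'\<in>UNIV. N (ketbra a a') b b * \<rho> a' a)"
    by (simp add: op_trace_def op_mult_def op_tensor_def sum_UNIV_pair choi_apply flip: mult.assoc)
  also have "\<dots> = (\<Sum>a\<in>UNIV. \<Sum>a'\<in>UNIV. \<Sum>b\<in>UNIV. N (ketbra a a') b b * \<rho> a' a)"
    by (intro sum.cong refl sum.swap)
  also have "\<dots> = op_trace UNIV \<rho>"
    by (simp add: tp op_trace_def flip: sum_distrib_right)
  finally show ?thesis .
qed

lemma ptranspose_tensor_kd: "ptranspose_snd (op_tensor \<rho> kd) = op_tensor \<rho> kd"
  by (auto simp: ptranspose_snd_def op_tensor_def fun_eq_iff kd_commute)

section \<open>Linearity of the value and convexity of the constraints\<close>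

lemma sdp_value_add: "sdp_value J (\<lambda>x y. X x y + Y x y) = sdp_value J X + sdp_value J Y"
  by (simp add: sdp_value_def op_trace_def op_mult_def distrib_left sum.distrib)

lemma sdp_value_scale: "sdp_value J (\<lambda>x y. of_real c * X x y) = c * sdp_value J X"
proof -
  have "op_trace UNIV (op_mult UNIV J (\<lambda>x y. of_real c * X x y)) =
      of_real c * op_trace UNIV (op_mult UNIV J X)"
    by (simp add: op_trace_def op_mult_def sum_distrib_left mult.left_commute)
  then show ?thesis
    by (simp add: sdp_value_def)
qed

lemma sdp_value_sum: "sdp_value J (\<lambda>x y. \<Sum>k\<in>K. X k x y) = (\<Sum>k\<in>K. sdp_value J (X k))"
proof (induction K rule: infinite_finite_induct)
  case (insert k K)
  then show ?case
    by (simp add: sdp_value_add)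
qed (simp_all add: sdp_value_def op_trace_def op_mult_def)

text \<open>Convexity along the segment towards \<open>op_tensor \<rho> kd\<close>, which is itself
  a point with the same \<rho> and parameter 1. It fills the gap between a feasible \<eta> and
  1.\<close>

lemma sdp_point_mix:
  fixes F :: "('a::finite \<times> 'b::finite) op"
  assumes "sdp_point ppt \<eta> F \<rho>" "0 \<le> t" "t \<le> 1"
  shows "sdp_point ppt ((1 - t) * \<eta> + t)
    (\<lambda>x y. of_real (1 - t) * F x y + of_real t * op_tensor \<rho> kd x y) \<rho>"
proof -
  define R where "R = (op_tensor \<rho> kd :: ('a \<times> 'b) op)"
  have F: "psd UNIV F" "psd UNIV (\<lambda>x y. R x y - F x y)" "op_trace UNIV \<rho> = 1"
    "trace_fst F = (\<lambda>b b'. of_real \<eta> * kd b b')"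
    using assms(1) by (auto simp: sdp_point_def loewner_le_def R_def)
  have R: "psd UNIV R"
    using psd_add [OF F(1,2)] by simp
  have mix: "psd UNIV (\<lambda>x y. of_real (1 - t) * G x y + of_real t * R x y)"
      "psd UNIV (\<lambda>x y. R x y - (of_real (1 - t) * G x y + of_real t * R x y))"
    if "psd UNIV G" "psd UNIV (\<lambda>x y. R x y - G x y)" for G
  proof -
    show "psd UNIV (\<lambda>x y. of_real (1 - t) * G x y + of_real t * R x y)"
      using assms(2,3) by (intro psd_add psd_scale that R) auto
    \<comment> \<open>Mixing with \<open>R\<close> shrinks the gap to \<open>R\<close> by the factor
      \<open>1 - t\<close>.\<close>
    have "psd UNIV (\<lambda>x y. of_real (1 - t) * (R x y - G x y))"
      using assms(3) by (intro psd_scale that) auto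
    then show "psd UNIV (\<lambda>x y. R x y - (of_real (1 - t) * G x y + of_real t * R x y))"
      by (simp add: algebra_simps)
  qed
  have "trace_fst R b b' = kd b b'" for b b'
    using F(3) by (simp add: trace_fst_def R_def op_tensor_def op_trace_def flip: sum_distrib_right)
  moreover have "trace_fst (\<lambda>x y. of_real (1 - t) * F x y + of_real t * R x y) =
      (\<lambda>b b'. of_real (1 - t) * trace_fst F b b' + of_real t * trace_fst R b b')"
    unfolding trace_fst_def by (simp only: sum.distrib sum_distrib_left)
  ultimately have "trace_fst (\<lambda>x y. of_real (1 - t) * F x y + of_real t * R x y) =
      (\<lambda>b b'. of_real ((1 - t) * \<eta> + t) * kd b b')"
    by (simp add: F(4) algebra_simps)
  moreover have "psd UNIV (ptranspose_snd (\<lambda>x y. of_real (1 - t) * F x y + of_real t * R x y))"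
     "psd UNIV (\<lambda>x y. R x y -
        ptranspose_snd (\<lambda>x y. of_real (1 - t) * F x y + of_real t * R x y) x y)" if ppt
  proof -
    have "ptranspose_snd (\<lambda>x y. of_real (1 - t) * F x y + of_real t * R x y) =
      (\<lambda>x y. of_real (1 - t) * ptranspose_snd F x y + of_real t * ptranspose_snd R x y)"
      by (auto simp: ptranspose_snd_def fun_eq_iff)
    then have eq: "ptranspose_snd (\<lambda>x y. of_real (1 - t) * F x y + of_real t * R x y) =
      (\<lambda>x y. of_real (1 - t) * ptranspose_snd F x y + of_real t * R x y)"
      by (simp add: R_def ptranspose_tensor_kd)
    have P: "psd UNIV (ptranspose_snd F)" "psd UNIV (\<lambda>x y. R x y - ptranspose_snd F x y)"
      using that assms(1) by (auto simp: sdp_point_def loewner_le_def R_def)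
    show "psd UNIV (ptranspose_snd (\<lambda>x y. of_real (1 - t) * F x y + of_real t * R x y))"
     "psd UNIV (\<lambda>x y. R x y -
        ptranspose_snd (\<lambda>x y. of_real (1 - t) * F x y + of_real t * R x y) x y)"
      unfolding eq by (rule mix [OF P])+
  qed
  ultimately show ?thesis
    using mix [OF F(1,2)] F(3) unfolding sdp_point_def loewner_le_def R_def [symmetric]
    by blast
qed

text \<open>A point from the maximally mixed state: \<open>c = 1 / m\<close> makes the maximization
  over codes non-empty, and \<open>c = 1\<close> makes the minimization of \<eta> feasible.\<close>

lemma sdp_point_uniform:
  fixes \<rho> :: "'a::finite op"
  defines "\<rho> \<equiv> (\<lambda>a a'. of_real (1 / real CARD('a)) * kd a a')"
  assumes "0 \<le> c" "c \<le> 1"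
  shows "sdp_point ppt c (\<lambda>x y. of_real c * op_tensor \<rho> (kd :: 'b::finite op) x y) \<rho>"
proof -
  define R where "R = (op_tensor \<rho> kd :: ('a \<times> 'b) op)"
  have "quad_form UNIV (kd :: ('a \<times> 'b) op) v = (\<Sum>x\<in>UNIV. cnj (v x) * v x)" for v
    by (simp add: mult.assoc flip: sum_distrib_left)
  then have "psd UNIV (kd :: ('a \<times> 'b) op)"
    by (simp add: psd_def complex_nonneg_iff sum_nonneg)
  then have "psd UNIV (\<lambda>x y. of_real (1 / real CARD('a)) * (kd :: ('a \<times> 'b) op) x y)"
    by (rule psd_scale) simp
  moreover have "(\<lambda>x y. of_real (1 / real CARD('a)) * (kd :: ('a \<times> 'b) op) x y) = R"
    by (auto simp: fun_eq_iff \<rho>_def R_def op_tensor_def kd_def)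
  ultimately have R: "psd UNIV R"
    by simp
  have tr: "op_trace UNIV \<rho> = 1"
    by (simp add: op_trace_def \<rho>_def)
  have "trace_fst R = kd"
    using tr by (simp add: trace_fst_def R_def op_tensor_def op_trace_def fun_eq_iff
        flip: sum_distrib_right)
  then have "trace_fst (\<lambda>x y. of_real c * R x y) = (\<lambda>b b'. of_real c * kd b b')"
    by (simp add: trace_fst_def fun_eq_iff flip: sum_distrib_left)
  moreover have "ptranspose_snd (\<lambda>x y. of_real c * R x y) = (\<lambda>x y. of_real c * R x y)"
    by (auto simp: R_def ptranspose_snd_def op_tensor_def fun_eq_iff kd_commute)
  moreover have "psd UNIV (\<lambda>x y. R x y - of_real c * R x y)"
    using psd_scale [OF R, of "1 - c"] assms(3) by (simp add: algebra_simps)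
  ultimately show ?thesis
    using tr psd_scale [OF R assms(2)] by (simp add: sdp_point_def loewner_le_def R_def)
qed

section \<open>Compactness of the set of points\<close>

lemma compact_coordinates:
  assumes "\<And>i. compact (C i)"
  shows "compact {f. \<forall>i. f i \<in> C i}"
proof -
  \<comment> \<open>Tychonoff's theorem: function types carry the product topology.\<close>
  have "compactin (product_topology (\<lambda>_. euclidean) UNIV) (PiE UNIV C)"
    using assms by (simp add: compactin_PiE)
  then show ?thesis
    by (simp add: euclidean_product_topology PiE_def Pi_def)
qed

text \<open>The constraints fix the trace of \<open>F\<close> to \<open>CARD('b) * \<eta>\<close>
  and that of \<open>op_tensor \<rho> kd\<close> to \<open>CARD('b)\<close>. Positivity of
  \<open>F\<close> and of the difference confines \<eta>, and entries are bounded by traces.\<close>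

lemma sdp_point_bounds:
  fixes F :: "('a::finite \<times> 'b::finite) op"
  assumes "sdp_point ppt \<eta> F \<rho>"
  shows "cmod (F x y) \<le> real CARD('b)" "cmod (\<rho> a a') \<le> real CARD('b)" "0 \<le> \<eta>" "\<eta> \<le> 1"
    "op_trace UNIV F = of_real (real CARD('b) * \<eta>)"
proof -
  define R where "R = (op_tensor \<rho> kd :: ('a \<times> 'b) op)"
  have F: "psd UNIV F" "psd UNIV (\<lambda>x y. R x y - F x y)" "op_trace UNIV \<rho> = 1"
    "trace_fst F = (\<lambda>b b'. of_real \<eta> * kd b b')"
    using assms by (auto simp: sdp_point_def loewner_le_def R_def)
  have R: "psd UNIV R"
    using psd_add [OF F(1,2)] by simp
  have trR: "op_trace UNIV R = of_nat CARD('b)"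
    using F(3) by (simp add: R_def op_trace_tensor_kd)
  show trF: "op_trace UNIV F = of_real (real CARD('b) * \<eta>)"
    using op_trace_trace_fst [of F] unfolding F(4) by (simp add: op_trace_def mult.commute)
  have "op_trace UNIV (\<lambda>x y. R x y - F x y) = of_real (real CARD('b) * (1 - \<eta>))"
    using trR trF by (simp add: op_trace_def sum_subtractf algebra_simps)
  then have "0 \<le> real CARD('b) * (1 - \<eta>)"
    using psd_trace_nonneg [OF F(2)] by (simp add: complex_nonneg_iff del: of_real_mult)
  then show "\<eta> \<le> 1"
    by (simp add: zero_le_mult_iff)
  have "0 \<le> real CARD('b) * \<eta>"
    using psd_trace_nonneg [OF F(1)] trF by (simp add: complex_nonneg_iff del: of_real_mult)
  then show "0 \<le> \<eta>"
    by (simp add: zero_le_mult_iff)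
  have "cmod (F x y) \<le> real CARD('b) * \<eta>"
    using psd_entry_le_trace [OF F(1), of x y] trF by simp
  also have "\<dots> \<le> real CARD('b)"
    using \<open>\<eta> \<le> 1\<close> by (simp add: mult_left_le)
  finally show "cmod (F x y) \<le> real CARD('b)" .
  \<comment> \<open>Any fixed diagonal position of the identity on B exposes the entries of
    \<rho>.\<close>
  have "cmod (R (a, undefined) (a', undefined)) \<le> real CARD('b)"
    using psd_entry_le_trace [OF R, of "(a, undefined)" "(a', undefined)"] trR by simp
  then show "cmod (\<rho> a a') \<le> real CARD('b)"
    by (simp add: R_def op_tensor_def)
qed

lemma continuous_on_coordinates:
  "continuous_on UNIV (\<lambda>z :: real \<times> 'i op \<times> 'j op. fst (snd z) x y)"
  "continuous_on UNIV (\<lambda>z :: real \<times> 'i op \<times> 'j op. snd (snd z) a a')"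
proof -
  have "continuous_on UNIV (\<lambda>z :: real \<times> 'i op \<times> 'j op. fst (snd z))"
    "continuous_on UNIV (\<lambda>z :: real \<times> 'i op \<times> 'j op. snd (snd z))"
    by (intro continuous_on_fst continuous_on_snd continuous_on_id)+
  then show "continuous_on UNIV (\<lambda>z :: real \<times> 'i op \<times> 'j op. fst (snd z) x y)"
    "continuous_on UNIV (\<lambda>z :: real \<times> 'i op \<times> 'j op. snd (snd z) a a')"
    by (metis continuous_on_product_then_coordinatewise)+
qed

text \<open>Every constraint is an equality or a weak inequality between continuous functions,
  positivity being one such condition per test vector; so the set is closed, and it lies in a
  compact box.\<close>

lemma compact_sdp_points:
  "compact {z :: real \<times> ('a::finite \<times> 'b::finite) op \<times> 'a op.
    sdp_point ppt (fst z) (fst (snd z)) (snd (snd z))}" (is "compact ?K")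
proof -
  let ?B = "cball (0::complex) (real CARD('b))"
  have c: "continuous_on UNIV (\<lambda>z. fst (z :: real \<times> ('a \<times> 'b) op \<times> 'a op))"
    by (intro continuous_intros)
  have psd_closed: "closed {z :: real \<times> ('a \<times> 'b) op \<times> 'a op. psd UNIV (G z)}"
    if "\<And>x y. continuous_on UNIV (\<lambda>z. G z x y)" for G :: "_ \<Rightarrow> ('a \<times> 'b) op"
    unfolding psd_def complex_nonneg_iff
    by (intro closed_Collect_all closed_Collect_conj closed_Collect_le closed_Collect_eq
        continuous_intros that)
  have R: "continuous_on UNIV (\<lambda>z. op_tensor (snd (snd (z :: real \<times> ('a \<times> 'b) op \<times> 'a op))) kd x y)"
    for x y :: "'a \<times> 'b"
    unfolding op_tensor_def case_prod_beta by (intro continuous_intros c continuous_on_coordinates)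
  have P: "continuous_on UNIV
      (\<lambda>z. ptranspose_snd (fst (snd (z :: real \<times> ('a \<times> 'b) op \<times> 'a op))) x y)"
    for x y :: "'a \<times> 'b"
    unfolding ptranspose_snd_def case_prod_beta
    by (intro continuous_intros c continuous_on_coordinates)
  have "closed ?K"
    unfolding sdp_point_def loewner_le_def fun_eq_iff op_trace_def trace_fst_def imp_conjR
    by (intro closed_Collect_conj psd_closed closed_Collect_all closed_Collect_eq closed_Collect_imp
        continuous_intros c continuous_on_coordinates R P open_Collect_const)
  moreover have "compact ({0..1} \<times> {F. \<forall>x. F x \<in> {f. \<forall>y. f y \<in> ?B}}
      \<times> {\<rho>. \<forall>x. \<rho> x \<in> {f. \<forall>y. f y \<in> ?B}} :: (real \<times> ('a \<times> 'b) op \<times> 'a op) set)" (is "compact ?L")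
    by (intro compact_Times compact_coordinates compact_Icc compact_cball)
  ultimately have "compact (?L \<inter> ?K)"
    by (rule compact_Int_closed [rotated])
  moreover have "?K \<subseteq> ?L"
    by (auto dest: sdp_point_bounds)
  then have "?L \<inter> ?K = ?K"
    by blast
  ultimately show ?thesis
    by simp
qed

section \<open>Codes and feasible points\<close>

lemma ptranspose_sum_scale:
  "ptranspose_snd (\<lambda>x y. \<Sum>k\<in>K. c k * X k x y) = (\<lambda>x y. \<Sum>k\<in>K. c k * ptranspose_snd (X k) x y)"
  by (auto simp: ptranspose_snd_def fun_eq_iff)

text \<open>Row sums minus diagonal terms leave the off-diagonal terms, which are positive as well.
  The abstract \<open>G\<close> stands for the blocks of a code and for their partial
  transposes.\<close>

lemma psd_diagonal_average:
  assumes "finite K" "\<And>k j. k \<in> K \<Longrightarrow> j \<in> K \<Longrightarrow> psd S (G k j)" "0 \<le> c"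
  shows "psd S (\<lambda>x y. \<Sum>k\<in>K. of_real c * G k k x y)"
    and "psd S (\<lambda>x y. (\<Sum>k\<in>K. of_real c * (\<Sum>j\<in>K. G k j x y)) -
      (\<Sum>k\<in>K. of_real c * G k k x y))"
proof -
  show "psd S (\<lambda>x y. \<Sum>k\<in>K. of_real c * G k k x y)"
    using assms by (intro psd_sum psd_scale) auto
  have "psd S (\<lambda>x y. \<Sum>k\<in>K. of_real c * (\<Sum>j\<in>K - {k}. G k j x y))"
    using assms by (intro psd_sum psd_scale) auto
  moreover have "(\<Sum>k\<in>K. of_real c * (\<Sum>j\<in>K - {k}. G k j x y)) =
      (\<Sum>k\<in>K. of_real c * (\<Sum>j\<in>K. G k j x y)) - (\<Sum>k\<in>K. of_real c * G k k x y)" for x y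
    using assms(1) by (simp add: sum_diff1 algebra_simps sum_subtractf)
  ultimately show "psd S (\<lambda>x y. (\<Sum>k\<in>K. of_real c * (\<Sum>j\<in>K. G k j x y)) -
      (\<Sum>k\<in>K. of_real c * G k k x y))"
    by simp
qed

lemma sdp_point_of_code:
  fixes Z :: "('a::finite, 'b::finite) message_code"
  assumes Z: "classical_registers {1..m} {1..m} Z" "ns_code {1..m} {1..m} Z"
    and ppt: "ppt \<Longrightarrow> ppt_code {1..m} {1..m} Z" and m: "1 \<le> m"
  shows "\<exists>F \<rho>. sdp_point ppt (1 / real m) F \<rho> \<and> success_prob N Z m = sdp_value (choi N) F"
proof -
  define S where "S = {1..m}"
  have S: "finite S" "card S = m" and one: "1 \<in> S"
    using m by (auto simp: S_def)
  have Z': "classical_registers S S Z"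
    using Z(1) by (simp add: S_def)
  have pZ: "psd (S \<times> UNIV \<times> UNIV \<times> S) Z"
    and tp: "\<And>i b b'. i \<in> S \<Longrightarrow> Z_AiBi S Z (i, b) (i, b') = kd b b'"
    and nsA: "\<And>i b b' j. i \<in> S \<Longrightarrow> j \<in> S \<Longrightarrow>
       Z_AiBiBo Z (i, b, j) (i, b', j) = 1 / of_nat m * Z_BiBo S Z (b, j) (b', j)"
    and nsB: "\<And>i b b' a a'. i \<in> S \<Longrightarrow>
       Z_AiBiAo S Z (i, b, a) (i, b', a') = kd b b' / of_nat CARD('b) * Z_AiAo S Z (i, a) (i, a')"
    using Z(2) S(2) unfolding ns_code_def S_def [symmetric] by (auto simp: kd_def)
  let ?c = "1 / real m"
  define F where "F = (\<lambda>x y. \<Sum>k\<in>S. of_real ?c * block Z k k x y)"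
  \<comment> \<open>The division by \<open>CARD('b)\<close> compensates the trace over
    \<open>B\<^sub>i\<close> in \<open>Z_AiAo\<close>; the indices are swapped as in
    \<open>block\<close>.\<close>
  define \<rho> where "\<rho> = (\<lambda>a a'. \<Sum>k\<in>S. of_real ?c * (Z_AiAo S Z (k, a') (k, a) / of_nat CARD('b)))"
  \<comment> \<open>No-signalling from Bob to Alice: a row sum is a product with the identity on
    B.\<close>
  have row: "(\<Sum>j\<in>S. block Z k j (a, b) (a', b')) =
      kd b b' * (Z_AiAo S Z (k, a') (k, a) / of_nat CARD('b))" if "k \<in> S" for k a b a' b'
    using nsB [OF that, of b' a' b a] by (simp add: block_def Z_AiBiAo_def kd_commute)
  have R: "op_tensor \<rho> kd x y = (\<Sum>k\<in>S. of_real ?c * (\<Sum>j\<in>S. block Z k j x y))" for x y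
    by (cases x; cases y) (simp add: row op_tensor_def \<rho>_def sum_distrib_left
        sum_distrib_right mult_ac)
  have G: "psd UNIV (block Z k j)" if "k \<in> S" "j \<in> S" for k j
    using pZ that unfolding psd_code_iff [OF Z' S(1) S(1)] by blast
  have "psd UNIV F" "psd UNIV (\<lambda>x y. op_tensor \<rho> kd x y - F x y)"
    unfolding R unfolding F_def by (rule psd_diagonal_average [OF S(1) G]; simp)+
  moreover have "psd UNIV (ptranspose_snd F)"
      "psd UNIV (\<lambda>x y. op_tensor \<rho> kd x y - ptranspose_snd F x y)" if ppt
  proof -
    have G': "psd UNIV (ptranspose_snd (block Z k j))" if "k \<in> S" "j \<in> S" for k j
      using ppt [OF \<open>ppt\<close>] that unfolding S_def [symmetric] ppt_code_iff [OF Z' S(1) S(1)] by blast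
    \<comment> \<open>The identity on B is invariant under transposition, so the row-sum identity
      passes to the partial transposes.\<close>
    have R': "op_tensor \<rho> kd x y = (\<Sum>k\<in>S. of_real ?c * (\<Sum>j\<in>S. ptranspose_snd (block Z k j) x y))"
      for x y :: "'a \<times> 'b"
    proof -
      have "op_tensor \<rho> kd x y = ptranspose_snd (op_tensor \<rho> kd) x y"
        by (simp add: ptranspose_tensor_kd)
      then show ?thesis
        by (simp add: ptranspose_snd_def R case_prod_beta)
    qed
    show "psd UNIV (ptranspose_snd F)"
        "psd UNIV (\<lambda>x y. op_tensor \<rho> kd x y - ptranspose_snd F x y)"
      unfolding R' unfolding F_def ptranspose_sum_scale
      by (rule psd_diagonal_average [OF S(1) G']; simp)+
  qed
  moreover have "op_trace UNIV \<rho> = 1"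
  proof -
    have "(\<Sum>a\<in>UNIV. Z_AiAo S Z (k, a) (k, a)) = of_nat CARD('b)" if "k \<in> S" for k
    proof -
      have "(\<Sum>a\<in>UNIV. Z_AiAo S Z (k, a) (k, a)) =
          (\<Sum>b\<in>UNIV. \<Sum>a\<in>UNIV. \<Sum>j\<in>S. Z (k, b, a, j) (k, b, a, j))"
        unfolding Z_AiAo_def prod.case by (rule sum.swap)
      then show ?thesis
        using tp [OF that] by (simp add: Z_AiBi_def)
    qed
    moreover have "op_trace UNIV \<rho> =
        (\<Sum>k\<in>S. of_real ?c * ((\<Sum>a\<in>UNIV. Z_AiAo S Z (k, a) (k, a)) / of_nat CARD('b)))"
      unfolding op_trace_def \<rho>_def sum_divide_distrib sum_distrib_left by (rule sum.swap)
    ultimately show ?thesis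
      using m S(2) by simp
  qed
  moreover have "trace_fst F = (\<lambda>b b'. of_real (1 / real m) * kd b b')"
  proof (intro ext)
    fix b b'
    have "(\<Sum>a\<in>UNIV. block Z i j (a, b) (a, b')) = 1 / of_nat m * Z_BiBo S Z (b', j) (b, j)"
      if "i \<in> S" "j \<in> S" for i j
      using nsA [OF that, of b' b] by (simp add: block_def Z_AiBiBo_def)
    \<comment> \<open>Trace preservation evaluates row 1. By no-signalling from Alice to Bob, each
      of its blocks has the same partial trace over A as the diagonal block of that column.\<close>
    moreover have "kd b b' = (\<Sum>j\<in>S. \<Sum>a\<in>UNIV. block Z 1 j (a, b) (a, b'))"
      using tp [OF one, of b' b] sum.swap [of "\<lambda>a j. Z (1, b', a, j) (1, b, a, j)" S UNIV]
      by (simp add: Z_AiBi_def block_def kd_commute)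
    ultimately have "kd b b' = (\<Sum>j\<in>S. \<Sum>a\<in>UNIV. block Z j j (a, b) (a, b'))"
      using one by simp
    moreover have "trace_fst F b b' =
        of_real (1 / real m) * (\<Sum>j\<in>S. \<Sum>a\<in>UNIV. block Z j j (a, b) (a, b'))"
      unfolding trace_fst_def F_def sum_distrib_left by (rule sum.swap)
    ultimately show "trace_fst F b b' = of_real (1 / real m) * kd b b'"
      by simp
  qed
  ultimately have "sdp_point ppt (1 / real m) F \<rho>"
    unfolding sdp_point_def loewner_le_def by blast
  moreover have "success_prob N Z m = sdp_value (choi N) F"
    unfolding success_prob_blocks F_def sdp_value_sum sdp_value_scale S_def
    by (simp add: sum_distrib_left)
  ultimately show ?thesis
    by blast
qed

text \<open>The code is invariant under permuting the messages simultaneously on both sides: one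
  operator for correct decoding and another for every error.\<close>

lemma code_of_sdp_point:
  fixes F :: "('a::finite \<times> 'b::finite) op"
  assumes F: "sdp_point ppt (1 / real m) F \<rho>" and m: "1 \<le> m"
  shows "\<exists>Z. classical_registers {1..m} {1..m} Z \<and> ns_code {1..m} {1..m} Z \<and>
    (ppt \<longrightarrow> ppt_code {1..m} {1..m} Z) \<and> success_prob N Z m = sdp_value (choi N) F"
proof -
  define S where "S = {1..m}"
  have S: "finite S" "card S = m"
    by (auto simp: S_def)
  define R where "R = (op_tensor \<rho> kd :: ('a \<times> 'b) op)"
  have pF: "psd UNIV F" "psd UNIV (\<lambda>x y. R x y - F x y)"
    and tr\<rho>: "op_trace UNIV \<rho> = 1" and trF: "trace_fst F = (\<lambda>b b'. of_real (1 / real m) * kd b b')"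
    using F by (auto simp: sdp_point_def loewner_le_def R_def)
  have trR: "(\<Sum>a\<in>UNIV. R (a, b) (a, b')) = kd b b'" for b b'
    using tr\<rho> by (simp add: R_def op_tensor_def op_trace_def flip: sum_distrib_right)
  \<comment> \<open>The weight lets the \<open>m - 1\<close> off-diagonal blocks complete each row
    to \<open>R\<close>. For \<open>m = 1\<close> the quotient is 0 and no off-diagonal labels
    exist.\<close>
  define G :: "nat \<Rightarrow> nat \<Rightarrow> ('a \<times> 'b) op"
    where "G = (\<lambda>i j x y. if i = j then F x y else of_real (1 / (real m - 1)) * (R x y - F x y))"
  \<comment> \<open>The deltas remove coherences; the swapped arguments of \<open>G\<close> undo the
    transposition in \<open>block\<close>.\<close>
  define Z :: "('a, 'b) message_code"
    where "Z = (\<lambda>(i, b, a, j) (i', b', a', j'). kd i i' * kd j j' * G i j (a', b') (a, b))"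
  have block: "block Z i j = G i j" for i j
    by (auto simp: block_def Z_def fun_eq_iff)
  have cl: "classical_registers S S Z"
    by (auto simp: classical_registers_def Z_def)
  have pG: "psd UNIV (G i j)" for i j
  proof (cases "i = j")
    case True
    then show ?thesis
      using pF(1) by (simp add: G_def)
  next
    case False
    then show ?thesis
      using psd_scale [OF pF(2), of "1 / (real m - 1)"] m by (simp add: G_def)
  qed
  have row: "(\<Sum>j\<in>S. G i j x y) = R x y" if "i \<in> S" for i x y
  proof (cases "m = 1")
    case True
    \<comment> \<open>With a single message the row is \<open>F\<close> alone, so
      \<open>F = R\<close> is required: both have trace \<open>CARD('b)\<close>, and a positive
      operator of trace zero vanishes.\<close>
    have "op_trace UNIV (\<lambda>x y. R x y - F x y) = 0"
      using op_trace_trace_fst [of F] trF True tr\<rho>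
      by (simp add: op_trace_def sum_subtractf R_def op_trace_tensor_kd [unfolded op_trace_def])
    then have "R x y - F x y = 0"
      by (rule psd_trace_zero [OF pF(2)])
    then show ?thesis
      using True that by (simp add: S_def G_def)
  next
    case False
    have "(\<Sum>j\<in>S. G i j x y) = F x y + (\<Sum>j\<in>S - {i}. G i j x y)"
      using that S(1) by (simp add: sum.remove G_def)
    also have "(\<Sum>j\<in>S - {i}. G i j x y) =
        (\<Sum>j\<in>S - {i}. of_real (1 / (real m - 1)) * (R x y - F x y))"
      by (intro sum.cong) (auto simp: G_def)
    also have "\<dots> = of_real (real m - 1) * of_real (1 / (real m - 1)) * (R x y - F x y)"
      using that S m by (simp add: of_nat_diff)
    also have "\<dots> = R x y - F x y"
      using False m by (simp flip: of_real_mult)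
    finally show ?thesis
      by simp
  qed
  \<comment> \<open>The common value for all labels is no-signalling from Alice to Bob; off the
    diagonal it rests on \<open>(1 - 1/m) / (m - 1) = 1/m\<close>.\<close>
  have col: "(\<Sum>a\<in>UNIV. G i j (a, b) (a, b')) = kd b b' / of_nat m"
    if "i \<in> S" "j \<in> S" for i j b b'
  proof (cases "i = j")
    case True
    then show ?thesis
      using fun_cong [OF fun_cong [OF trF, of b], of b'] by (simp add: G_def trace_fst_def)
  next
    case False
    \<comment> \<open>Two distinct labels force \<open>m\<close> to be at least 2, so the division
      is genuine.\<close>
    then have m2: "real m - 1 \<noteq> 0"
      using that m by (auto simp: S_def)
    have "(\<Sum>a\<in>UNIV. G i j (a, b) (a, b')) =
        of_real (1 / (real m - 1)) * (kd b b' - trace_fst F b b')"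
      using False by (simp add: G_def trace_fst_def sum_subtractf trR flip: sum_divide_distrib)
    also have "\<dots> = of_real (1 / (real m - 1) * (1 - 1 / real m)) * kd b b'"
      unfolding trF
      by (simp only: of_real_mult of_real_diff of_real_1 left_diff_distrib right_diff_distrib
          mult_1_left mult_1_right mult.assoc)
    also have "1 / (real m - 1) * (1 - 1 / real m) = 1 / real m"
      using m2 m by (simp add: field_simps)
    finally show ?thesis
      by simp
  qed
  have "psd (S \<times> UNIV \<times> UNIV \<times> S) Z"
    by (simp add: psd_code_iff [OF cl S(1) S(1)] block pG)
  moreover have "Z_AiBi S Z x y = kd x y" if in_S: "x \<in> S \<times> UNIV" "y \<in> S \<times> UNIV" for x y
  proof -
    obtain i b i' b' where xy: "x = (i, b)" "y = (i', b')" and i: "i \<in> S"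
      using in_S by auto
    have "(\<Sum>a\<in>UNIV. \<Sum>j\<in>S. G i j (a, b') (a, b)) = kd b' b"
      by (simp add: row [OF i] trR)
    then show ?thesis
      by (auto simp: xy Z_AiBi_def Z_def kd_def)
  qed
  moreover have col': "Z_AiBiBo Z (i, b, j) (i', b', j') = kd i i' * kd j j' * kd b b' / of_nat m"
    if "i \<in> S" "j \<in> S" for i b j i' b' j'
    by (simp add: Z_AiBiBo_def Z_def col that kd_commute [of b'] flip: sum_distrib_left)
  moreover have "Z_BiBo S Z (b, j) (b', j') = kd j j' * kd b b'" if "j \<in> S" for b j b' j'
  proof -
    have "Z_BiBo S Z (b, j) (b', j') = (\<Sum>i\<in>S. Z_AiBiBo Z (i, b, j) (i, b', j'))"
      by (simp add: Z_BiBo_def Z_AiBiBo_def)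
    then show ?thesis
      using m S(2) that by (simp add: col')
  qed
  moreover have row': "Z_AiBiAo S Z (i, b, a) (i', b', a') = kd i i' * (\<rho> a' a * kd b b')"
    if "i \<in> S" for i b a i' b' a'
    using row [OF that, of "(a', b')" "(a, b)"]
    by (simp add: Z_AiBiAo_def Z_def R_def op_tensor_def kd_commute [of b'] flip: sum_distrib_left)
  moreover have "Z_AiAo S Z (i, a) (i', a') = of_nat CARD('b) * (kd i i' * \<rho> a' a)"
    if "i \<in> S" for i a i' a'
  proof -
    have "Z_AiAo S Z (i, a) (i', a') = (\<Sum>b\<in>UNIV. Z_AiBiAo S Z (i, b, a) (i', b, a'))"
      by (simp add: Z_AiAo_def Z_AiBiAo_def)
    then show ?thesis
      using that by (simp add: row')
  qed
  ultimately have "ns_code S S Z"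
    using S(2) m unfolding ns_code_def by simp
  moreover have "ppt_code S S Z" if ppt
  proof -
    have P: "psd UNIV (ptranspose_snd F)" "psd UNIV (\<lambda>x y. R x y - ptranspose_snd F x y)"
      using F that by (auto simp: sdp_point_def loewner_le_def R_def)
    have "psd UNIV (ptranspose_snd (G i j))" for i j
    proof (cases "i = j")
      case True
      then show ?thesis
        using P(1) by (simp add: G_def)
    next
      case False
      have "ptranspose_snd (G i j) = (\<lambda>x y. of_real (1 / (real m - 1)) *
          (ptranspose_snd (op_tensor \<rho> kd) x y - ptranspose_snd F x y))"
        using False by (auto simp: G_def R_def ptranspose_snd_def fun_eq_iff)
      then show ?thesis
        using psd_scale [OF P(2), of "1 / (real m - 1)"] m
        by (simp add: ptranspose_tensor_kd R_def)
    qed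
    then show ?thesis
      by (simp add: ppt_code_iff [OF cl S(1) S(1)] block)
  qed
  moreover have "success_prob N Z m = sdp_value (choi N) F"
    using m by (simp add: success_prob_blocks block G_def)
  ultimately show ?thesis
    using cl unfolding S_def by blast
qed

text \<open>Replaces codes by points, which turns the supremum over codes into one of a continuous
  function on a compact set.\<close>

lemma success_prob_image:
  fixes N :: "'a::finite op \<Rightarrow> 'b::finite op"
  assumes "1 \<le> m"
  shows "(\<lambda>Z. success_prob N Z m) ` (if ppt then ns_ppt_codes else ns_codes) m =
    {sdp_value (choi N) F | F \<rho>. sdp_point ppt (1 / real m) F \<rho>}"
proof (intro subset_antisym subsetI)
  fix v assume "v \<in> (\<lambda>Z. success_prob N Z m) ` (if ppt then ns_ppt_codes else ns_codes) m"
  then obtain Z where v: "v = success_prob N Z m" and Z: "classical_registers {1..m} {1..m} Z"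
    "ns_code {1..m} {1..m} Z" "ppt \<Longrightarrow> ppt_code {1..m} {1..m} Z"
    by (auto simp: ns_ppt_codes_def ns_codes_def split: if_splits)
  show "v \<in> {sdp_value (choi N) F | F \<rho>. sdp_point ppt (1 / real m) F \<rho>}"
    using sdp_point_of_code [OF Z assms, where N = N] v by blast
next
  fix v assume "v \<in> {sdp_value (choi N) F | F \<rho>. sdp_point ppt (1 / real m) F \<rho>}"
  then obtain F \<rho> where v: "v = sdp_value (choi N) F" and F: "sdp_point ppt (1 / real m) F \<rho>"
    by blast
  obtain Z where "classical_registers {1..m} {1..m} Z" "ns_code {1..m} {1..m} Z"
    "ppt \<longrightarrow> ppt_code {1..m} {1..m} Z" "success_prob N Z m = v"
    using code_of_sdp_point [OF F assms, where N = N] v by blast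
  then show "v \<in> (\<lambda>Z. success_prob N Z m) ` (if ppt then ns_ppt_codes else ns_codes) m"
    by (auto simp: ns_ppt_codes_def ns_codes_def)
qed

section \<open>Attained optima and the capacity\<close>

lemma continuous_on_sdp_value:
  "continuous_on UNIV
    (\<lambda>z :: real \<times> ('a::finite \<times> 'b::finite) op \<times> 'a op. sdp_value J (fst (snd z)))"
  unfolding sdp_value_def op_trace_def op_mult_def
  by (intro continuous_intros continuous_on_coordinates)

text \<open>The supremum is a maximum by compactness, so a threshold on it is met exactly when a
  single point meets it, including in the boundary case.\<close>

lemma opt_success_prob_attained:
  fixes N :: "'a::finite op \<Rightarrow> 'b::finite op"
  assumes "1 \<le> m"
  shows "c \<le> opt_success_prob (if ppt then ns_ppt_codes else ns_codes) N m \<longleftrightarrow>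
    (\<exists>F \<rho>. sdp_point ppt (1 / real m) F \<rho> \<and> c \<le> sdp_value (choi N) F)"
proof -
  define V where "V = {sdp_value (choi N) F | F \<rho>. sdp_point ppt (1 / real m) F \<rho>}"
  \<comment> \<open>The slice \<eta> = \<open>1 / m\<close> of the compact set of points.\<close>
  define K where "K = {z :: real \<times> ('a \<times> 'b) op \<times> 'a op.
    sdp_point ppt (fst z) (fst (snd z)) (snd (snd z))} \<inter> {z. fst z = 1 / real m}"
  have "compact K"
    unfolding K_def
    by (intro compact_Int_closed compact_sdp_points closed_Collect_eq continuous_intros)
  then have "compact ((\<lambda>z. sdp_value (choi N) (fst (snd z))) ` K)"
    using continuous_on_sdp_value continuous_on_subset by (intro compact_continuous_image) blast+
  also have "(\<lambda>z. sdp_value (choi N) (fst (snd z))) ` K = V"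
  proof (intro subset_antisym subsetI)
    fix v assume "v \<in> V"
    then obtain F \<rho> where "v = sdp_value (choi N) F" "sdp_point ppt (1 / real m) F \<rho>"
      by (auto simp: V_def)
    then show "v \<in> (\<lambda>z. sdp_value (choi N) (fst (snd z))) ` K"
      by (intro image_eqI [of _ _ "(1 / real m, F, \<rho>)"]) (auto simp: K_def)
  qed (auto simp: K_def V_def, blast)
  finally have "compact V" .
  moreover have "V \<noteq> {}"
    using sdp_point_uniform [of "1 / real m" ppt] assms by (auto simp: V_def)
  ultimately obtain v where v: "v \<in> V" "\<And>w. w \<in> V \<Longrightarrow> w \<le> v"
    using compact_attains_sup [of V] by blast
  then have "opt_success_prob (if ppt then ns_ppt_codes else ns_codes) N m = v"
    unfolding opt_success_prob_def success_prob_image [OF assms] V_def [symmetric]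
    by (intro cSup_eq_maximum)
  then show ?thesis
    using v unfolding V_def by (auto intro: order.trans)
qed

lemma capacity_eq_minimum:
  fixes N :: "'a::finite op \<Rightarrow> 'b::finite op" and ppt :: bool
  assumes N: "trace_preserving N" and \<epsilon>: "0 \<le> \<epsilon>" "\<epsilon> < 1"
  defines "\<Omega> \<equiv> if ppt then ns_ppt_codes else ns_codes"
  shows "\<exists>\<eta>. is_minimum {\<eta>. \<exists>F \<rho>. sdp_point ppt \<eta> F \<rho> \<and> 1 - \<epsilon> \<le> sdp_value (choi N) F} \<eta> \<and>
    one_shot_capacity \<Omega> N \<epsilon> = log 2 (of_int \<lfloor>1 / \<eta>\<rfloor>) \<and>
    (1 / \<eta> \<in> \<int> \<longrightarrow> one_shot_capacity \<Omega> N \<epsilon> = - log 2 \<eta>)"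
proof -
  define E where "E = {\<eta>. \<exists>F \<rho>. sdp_point ppt \<eta> F \<rho> \<and> 1 - \<epsilon> \<le> sdp_value (choi N) F}"
  have value_R: "sdp_value (choi N) (op_tensor \<rho> kd) = 1" if "sdp_point ppt \<eta> F \<rho>"
    for \<eta> \<rho> and F :: "('a \<times> 'b) op"
    using that trace_choi_tensor_kd [OF N] by (simp add: sdp_value_def sdp_point_def)
  define K where "K = {z :: real \<times> ('a \<times> 'b) op \<times> 'a op.
    sdp_point ppt (fst z) (fst (snd z)) (snd (snd z))} \<inter>
    {z. 1 - \<epsilon> \<le> sdp_value (choi N) (fst (snd z))}"
  have "compact K"
    unfolding K_def
    by (intro compact_Int_closed compact_sdp_points closed_Collect_le continuous_on_const
        continuous_on_sdp_value)
  then have "compact (fst ` K)"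
    by (intro compact_continuous_image continuous_on_fst continuous_on_id)
  also have "fst ` K = E"
  proof (intro subset_antisym subsetI)
    fix \<eta> assume "\<eta> \<in> E"
    then obtain F \<rho> where "sdp_point ppt \<eta> F \<rho>" "1 - \<epsilon> \<le> sdp_value (choi N) F"
      by (auto simp: E_def)
    then show "\<eta> \<in> fst ` K"
      by (intro image_eqI [of _ _ "(\<eta>, F, \<rho>)"]) (auto simp: K_def)
  qed (auto simp: K_def E_def)
  finally have "compact E" .
  \<comment> \<open>The operator \<open>op_tensor \<rho> kd\<close> has parameter 1 and success
    value 1, which satisfies every nonnegative error bound.\<close>
  moreover have "1 \<in> E"
  proof -
    obtain \<rho> where \<rho>: "sdp_point ppt 1 (op_tensor \<rho> kd :: ('a \<times> 'b) op) \<rho>"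
      using sdp_point_uniform [of 1 ppt, where ?'a = 'a and ?'b = 'b] by auto
    moreover have "1 - \<epsilon> \<le> sdp_value (choi N) (op_tensor \<rho> kd)"
      using value_R [OF \<rho>] \<epsilon>(1) by simp
    ultimately show ?thesis
      unfolding E_def by blast
  qed
  ultimately obtain \<eta> where \<eta>: "\<eta> \<in> E" "\<And>\<eta>'. \<eta>' \<in> E \<Longrightarrow> \<eta> \<le> \<eta>'"
    using compact_attains_inf [of E] by blast
  then obtain F \<rho> where F: "sdp_point ppt \<eta> F \<rho>" "1 - \<epsilon> \<le> sdp_value (choi N) F"
    by (auto simp: E_def)
  \<comment> \<open>At \<eta> = 0 the trace of \<open>F\<close> vanishes, so \<open>F\<close> and
    its value are zero, against \<open>1 - \<epsilon> > 0\<close>. This makes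
    \<open>1 / \<eta>\<close> meaningful.\<close>
  have "\<eta> \<noteq> 0"
  proof
    assume "\<eta> = 0"
    then have "op_trace UNIV F = 0"
      using sdp_point_bounds(5) [OF F(1)] by simp
    then have "F x y = 0" for x y
      using F(1) psd_trace_zero unfolding sdp_point_def by blast
    then have "sdp_value (choi N) F = 0"
      by (simp add: sdp_value_def op_trace_def op_mult_def)
    then show False
      using F(2) \<epsilon>(2) by simp
  qed
  then have pos: "0 < \<eta>" and "\<eta> \<le> 1"
    using sdp_point_bounds(3,4) [OF F(1)] by auto
  have up: "\<eta>' \<in> E" if \<eta>': "\<eta> \<le> \<eta>'" "\<eta>' \<le> 1" for \<eta>'
  proof (cases "\<eta> = 1")
    case True
    then show ?thesis
      using \<eta>(1) \<eta>' by simp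
  next
    case False
    \<comment> \<open>The solution of \<open>(1 - t) * \<eta> + t = \<eta>'\<close>; the case \<eta>
      = 1 is split off to keep the denominator nonzero.\<close>
    define t where "t = (\<eta>' - \<eta>) / (1 - \<eta>)"
    have "t * (1 - \<eta>) = \<eta>' - \<eta>"
      using False by (simp add: t_def)
    then have "(1 - t) * \<eta> + t = \<eta>'"
      by (simp add: algebra_simps)
    moreover have "0 \<le> t" "t \<le> 1"
      using \<eta>' \<open>\<eta> \<le> 1\<close> False by (simp_all add: t_def)
    ultimately have t: "0 \<le> t" "t \<le> 1" "(1 - t) * \<eta> + t = \<eta>'"
      by blast+
    \<comment> \<open>Mixing towards a point of value 1 keeps the value at least
      \<open>1 - \<epsilon>\<close>.\<close>
    have "(1 - t) * (1 - \<epsilon>) + t * 1 \<le> (1 - t) * sdp_value (choi N) F + t * 1"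
      using F(2) t by (intro add_right_mono mult_left_mono) auto
    moreover have "1 - \<epsilon> \<le> (1 - t) * (1 - \<epsilon>) + t * 1"
      using t(1) \<epsilon>(1) by (simp add: algebra_simps)
    ultimately have "1 - \<epsilon> \<le>
        sdp_value (choi N) (\<lambda>x y. of_real (1 - t) * F x y + of_real t * op_tensor \<rho> kd x y)"
      unfolding sdp_value_add sdp_value_scale value_R [OF F(1)] by linarith
    then show ?thesis
      using sdp_point_mix [OF F(1) t(1,2)] unfolding E_def t(3) by blast
  qed
  have iff: "1 - opt_success_prob \<Omega> N l \<le> \<epsilon> \<longleftrightarrow> int l \<le> \<lfloor>1 / \<eta>\<rfloor>" if l: "1 \<le> l" for l
  proof -
    have "1 - opt_success_prob \<Omega> N l \<le> \<epsilon> \<longleftrightarrow> 1 - \<epsilon> \<le> opt_success_prob \<Omega> N l"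
      by linarith
    also have "\<dots> \<longleftrightarrow> 1 / real l \<in> E"
      unfolding \<Omega>_def opt_success_prob_attained [OF l] E_def by blast
    \<comment> \<open>Minimality gives one direction; the other holds because \<open>E\<close>
      contains everything from \<eta> to 1.\<close>
    also have "\<dots> \<longleftrightarrow> \<eta> \<le> 1 / real l"
      using \<eta>(2) up l by auto
    also have "\<dots> \<longleftrightarrow> real l \<le> 1 / \<eta>"
      using l pos by (simp add: field_simps)
    finally show ?thesis
      by (simp add: le_floor_iff)
  qed
  have one: "1 \<le> \<lfloor>1 / \<eta>\<rfloor>"
    using pos \<open>\<eta> \<le> 1\<close> by (simp add: le_floor_iff)
  \<comment> \<open>The largest admissible number of messages; it is at least 1 because \<eta> is at
    most 1.\<close>
  define M where "M = nat \<lfloor>1 / \<eta>\<rfloor>"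
  have M: "1 \<le> M" "int M = \<lfloor>1 / \<eta>\<rfloor>"
    using one unfolding M_def by linarith+
  have "one_shot_capacity \<Omega> N \<epsilon> = log 2 (real M)"
    unfolding one_shot_capacity_def
  proof (rule cSup_eq_maximum)
    show "log 2 (real M) \<in> {log 2 (real l) |l. 1 \<le> l \<and> 1 - opt_success_prob \<Omega> N l \<le> \<epsilon>}"
      using M iff by auto
  next
    fix x assume "x \<in> {log 2 (real l) |l. 1 \<le> l \<and> 1 - opt_success_prob \<Omega> N l \<le> \<epsilon>}"
    then obtain l where "x = log 2 (real l)" "1 \<le> l" "int l \<le> int M"
      using iff M(2) by auto
    then show "x \<le> log 2 (real M)"
      by simp
  qed
  also have "real M = of_int \<lfloor>1 / \<eta>\<rfloor>"
    using M(2) by (metis of_int_of_nat_eq)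
  finally have cap: "one_shot_capacity \<Omega> N \<epsilon> = log 2 (of_int \<lfloor>1 / \<eta>\<rfloor>)" .
  moreover have "one_shot_capacity \<Omega> N \<epsilon> = - log 2 \<eta>" if "1 / \<eta> \<in> \<int>"
  proof -
    have "of_int \<lfloor>1 / \<eta>\<rfloor> = 1 / \<eta>"
      using that by (auto elim: Ints_cases)
    then have "one_shot_capacity \<Omega> N \<epsilon> = log 2 (1 / \<eta>)"
      by (simp only: cap)
    then show ?thesis
      using pos by (simp add: log_divide)
  qed
  moreover have "is_minimum E \<eta>"
    using \<eta> by (simp add: is_minimum_def)
  ultimately show ?thesis
    unfolding E_def by blast
qed

theorem theorem4:
  fixes N :: "'a::finite op \<Rightarrow> 'b::finite op" and \<epsilon> :: real
  assumes "quantum_channel N" and "0 \<le> \<epsilon>" and "\<epsilon> < 1"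
  shows "(\<exists>\<eta>. is_minimum {\<eta>. \<exists>F \<rho>. ns_ppt_feasible (choi N) \<epsilon> \<eta> F \<rho>} \<eta> \<and>
            one_shot_capacity ns_ppt_codes N \<epsilon> = log 2 (of_int \<lfloor>1 / \<eta>\<rfloor>) \<and>
            (1 / \<eta> \<in> \<int> \<longrightarrow> one_shot_capacity ns_ppt_codes N \<epsilon> = - log 2 \<eta>)) \<and>
         (\<exists>\<eta>. is_minimum {\<eta>. \<exists>F \<rho>. ns_feasible (choi N) \<epsilon> \<eta> F \<rho>} \<eta> \<and>
            one_shot_capacity ns_codes N \<epsilon> = log 2 (of_int \<lfloor>1 / \<eta>\<rfloor>) \<and>
            (1 / \<eta> \<in> \<int> \<longrightarrow> one_shot_capacity ns_codes N \<epsilon> = - log 2 \<eta>))"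
proof -
  have J: "psd UNIV (choi N)" and tp: "trace_preserving N"
    using assms(1) psd_choi by (auto simp: quantum_channel_def)
  \<comment> \<open>The complex inequality also demands equal imaginary parts, which positivity of
    \<open>choi N\<close> and \<open>F\<close> guarantees.\<close>
  have success: "of_real (1 - \<epsilon>) \<le> op_trace UNIV (op_mult UNIV (choi N) F) \<longleftrightarrow>
      1 - \<epsilon> \<le> sdp_value (choi N) F" if "psd UNIV F" for F
    using trace_mult_psd_real [OF J that] by (simp add: less_eq_complex_def sdp_value_def)
  have ns: "ns_feasible (choi N) \<epsilon> \<eta> F \<rho> \<longleftrightarrow>
      sdp_point False \<eta> F \<rho> \<and> 1 - \<epsilon> \<le> sdp_value (choi N) F" for \<eta> F \<rho>
    using success unfolding ns_feasible_def sdp_point_def by auto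
  have ns_ppt: "ns_ppt_feasible (choi N) \<epsilon> \<eta> F \<rho> \<longleftrightarrow>
      sdp_point True \<eta> F \<rho> \<and> 1 - \<epsilon> \<le> sdp_value (choi N) F" for \<eta> F \<rho>
    using success unfolding ns_ppt_feasible_def ns_feasible_def sdp_point_def by auto
  show ?thesis
    unfolding ns ns_ppt
    using capacity_eq_minimum [OF tp assms(2,3), of True]
      capacity_eq_minimum [OF tp assms(2,3), of False] by simp
qed

end
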